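(* Let $N$ be a non-negative integer and let $p\in\mathbb{C}$, $p\neq 0,1$. Then the Krawtchouk polynomials $K_n(x;p,N)$, $n\ge0$, are orthogonal with respect to the $\Delta$-Sobolev form $$\langle r,q\rangle_S=\langle r,q\rangle_d+\left\langle\Delta^{N+1}r,\Delta^{N+1}q\right\rangle_c,$$ with $$\langle r,q\rangle_d=\sum_{x=0}^{N}r(x)q(x)\frac{p^x(1-p)^{N-x}}{\Gamma(x+1)\Gamma(N-x+1)},\qquad \langle r,q\rangle_c=\int_C r(z)q(z)\,\Gamma(-z)\Gamma(1+z)\left(\frac{p}{1-p}\right)^z dz,$$ where $C$ is the imaginary axis deformed so as to separate the increasing from the decreasing sequence of poles of the weight function; in fact, one can take $C=\{-1/2+ti:t\in\mathbb{R}\}$. That is, $\langle K_n(\cdot;p,N),K_m(\cdot;p,N)\rangle_S=0$ for all $n\ne m$ in $\mathbb{N}_0$.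
   Context: $\mathbb{N}_0=\{0,1,2,\dots\}$; $(a)_0=1$, $(a)_n=a(a+1)\cdots(a+n-1)$; $\Delta f(x)=f(x+1)-f(x)$; $w^z=e^{z\log w}$. The increasing poles of $\Gamma(-z)\Gamma(1+z)$ are $0,1,2,\dots$ and the decreasing ones are $-1,-2,\dots$. Monic Krawtchouk polynomials are $K_n(x;p,N)=(-N)_np^n\,{}_2F_1\!\left(\begin{array}{c}-n,\ -x\\-N\end{array}\Big|\frac1p\right)$, which in the form valid for every degree $n\ge0$ reads $$K_n(x;p,N)=\sum_{k=0}^n\frac{(-n)_k(-x)_k}{k!}(-N+k)_{n-k}\,p^{n-k}.$$
   Formalization: C is any separating curve on which the integrals of polynomials against the weight converge absolutely (such C is proved to exist); C={-1/2+ti} is allowed exactly when p/(1-p) is not a negative real, since otherwise the integral over that line diverges. *)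

theory Defs
  imports "HOL-Analysis.Analysis"
begin

definition krawtchouk :: "nat \<Rightarrow> complex \<Rightarrow> nat \<Rightarrow> complex \<Rightarrow> complex" where
  "krawtchouk n p N x =
     (\<Sum>k=0..n. pochhammer (- of_nat n) k * pochhammer (- x) k / fact k
               * pochhammer (- of_nat N + of_nat k) (n - k) * p ^ (n - k))"

definition fwd_diff :: "(complex \<Rightarrow> complex) \<Rightarrow> complex \<Rightarrow> complex" where
  "fwd_diff f x = f (x + 1) - f x"

definition discrete_form ::
    "complex \<Rightarrow> nat \<Rightarrow> (complex \<Rightarrow> complex) \<Rightarrow> (complex \<Rightarrow> complex) \<Rightarrow> complex" where
  "discrete_form p N r q =
     (\<Sum>x=0..N. r (of_nat x) * q (of_nat x) *
        (p ^ x * (1 - p) ^ (N - x) /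
         (Gamma (of_nat x + 1) * Gamma (of_nat N - of_nat x + 1))))"

definition cont_weight :: "complex \<Rightarrow> complex \<Rightarrow> complex" where
  "cont_weight p z = Gamma (- z) * Gamma (1 + z) * (p / (1 - p)) powr z"

definition increasing_poles :: "complex set" where
  "increasing_poles = range (\<lambda>k::nat. of_nat k)"

definition decreasing_poles :: "complex set" where
  "decreasing_poles = range (\<lambda>k::nat. - of_nat (Suc k))"

text \<open>
  The deformed imaginary axis is a piecewise smooth curve from \<open>-i\<infinity>\<close> to \<open>i\<infinity>\<close>,
  parametrized over the whole real line.  It separates the two sequences of poles if each
  sequence lies on one side of it (that is, in a single component of the complement) and the
  two sides are different.  In particular the curve avoids all poles.  The real part need not
  stay bounded: see the remark at \<open>weight_integrable\<close> below.
\<close>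

definition separating_contour :: "(real \<Rightarrow> complex) \<Rightarrow> bool" where
  "separating_contour C \<longleftrightarrow>
     C piecewise_C1_differentiable_on UNIV \<and>
     filterlim (\<lambda>t. Im (C t)) at_bot at_bot \<and>
     filterlim (\<lambda>t. Im (C t)) at_top at_top \<and>
     (\<forall>a\<in>increasing_poles. \<forall>b\<in>increasing_poles. connected_component (- range C) a b) \<and>
     (\<forall>a\<in>decreasing_poles. \<forall>b\<in>decreasing_poles. connected_component (- range C) a b) \<and>
     (\<forall>a\<in>increasing_poles. \<forall>b\<in>decreasing_poles. \<not> connected_component (- range C) a b)"

definition vertical_line :: "real \<Rightarrow> complex" where
  "vertical_line t = - 1 / 2 + of_real t * \<i>"

text \<open>
  The contour integral is \<open>\<integral> r(C(t)) q(C(t)) \<omega>(C(t)) C'(t) dt\<close> over the real line.  Since the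
  Bochner integral of a non-integrable function is \<open>0\<close> by convention, \<open>cont_form\<close> only has
  its intended meaning when the integral converges; \<open>weight_integrable\<close> says that it does so
  (absolutely) for all polynomials.

  On the line of abscissa \<open>-1/2\<close> the weight has modulus
  \<open>const * exp (- t * Arg (p / (1 - p))) / cosh (pi * t)\<close>, so it is not integrable if
  \<open>p / (1 - p)\<close> is a negative real.  For such \<open>p\<close> one has \<open>\<bar>p / (1 - p)\<bar> \<noteq> 1\<close>, and a contour whose
  ends are bent to the right (modulus below 1) or to the left (modulus above 1) is suitable.
\<close>

definition cont_form ::
    "complex \<Rightarrow> (real \<Rightarrow> complex) \<Rightarrow> (complex \<Rightarrow> complex) \<Rightarrow> (complex \<Rightarrow> complex) \<Rightarrow> complex" where
  "cont_form p C r q =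
     (LINT t|lborel. r (C t) * q (C t) * cont_weight p (C t) * vector_derivative C (at t))"

definition weight_integrable :: "complex \<Rightarrow> (real \<Rightarrow> complex) \<Rightarrow> bool" where
  "weight_integrable p C \<longleftrightarrow>
     (\<forall>r :: complex poly.
        integrable lborel (\<lambda>t. poly r (C t) * cont_weight p (C t) * vector_derivative C (at t)))"

definition sobolev_form ::
    "complex \<Rightarrow> nat \<Rightarrow> (real \<Rightarrow> complex) \<Rightarrow> (complex \<Rightarrow> complex) \<Rightarrow> (complex \<Rightarrow> complex) \<Rightarrow> complex" where
  "sobolev_form p N C r q =
     discrete_form p N r q + cont_form p C ((fwd_diff ^^ (N + 1)) r) ((fwd_diff ^^ (N + 1)) q)"

end

theory Submission
  imports Defs "HOL-Complex_Analysis.Complex_Analysis" "HOL-Probability.Sinc_Integral"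
begin

text \<open>
  Both halves of the form come from one difference operator \<open>D\<^sub>\<nu>\<close> (\<open>kdiff\<close>): \<open>K\<^sub>n\<close> is an eigenfunction
  of \<open>D\<^sub>N\<close> with eigenvalue \<open>-n\<close>, and since \<open>\<Delta> D\<^sub>\<nu> = D\<^sub>\<nu>\<^sub>-\<^sub>1 \<Delta> - \<Delta>\<close>, the function \<open>\<Delta>\<^sup>N\<^sup>+\<^sup>1 K\<^sub>n\<close> is
  an eigenfunction of \<open>D\<^sub>-\<^sub>1\<close> with eigenvalue \<open>N + 1 - n\<close>.  Distinct eigenvalues make the
  functions orthogonal as soon as \<open>D\<^sub>N\<close> is symmetric for the discrete form (a telescoping sum) and
  \<open>D\<^sub>-\<^sub>1\<close> is symmetric for the contour form.

  The latter amounts to \<open>\<integral>\<^sub>C (p (z + 1) q(z + 1) + (1 - p) z q(z)) w(z) dz = 0\<close> for all polynomials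
  \<open>q\<close>.  As \<open>w(z + 1) = - p / (1 - p) w(z)\<close>, the integrand is \<open>g(z + 1) - g(z)\<close> with
  \<open>g(z) = - (1 - p) z q(z) w(z)\<close> regular at \<open>0\<close>; hence \<open>F(z) = \<integral>\<^sub>z\<^sup>z\<^sup>+\<^sup>1 g\<close> is a primitive away from the
  real rays through the poles.  The contour may cross these rays, but the separation hypothesis
  makes the winding numbers about all poles vanish once a long piece of \<open>C\<close> is closed up through
  the gap between \<open>-1\<close> and \<open>0\<close>, so that \<open>F\<close> computes the integral over that piece.  Finally \<open>F\<close> is
  bounded by a polynomial times \<open>w\<close>, which becomes small along some points of \<open>C\<close> in both
  directions because \<open>C\<close> has infinite length.

  For the existence of a contour, the parabolas \<open>x = \<sigma> y\<^sup>2 - 1/2\<close> suffice.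
\<close>

subsection \<open>The difference equation\<close>

text \<open>The second-order difference operator of the Krawtchouk equation with N replaced by a
  free parameter \<nu>, since every forward difference lowers this parameter by one; the value -1 is
  the one attached to the contour weight.\<close>

definition kdiff :: "complex \<Rightarrow> complex \<Rightarrow> (complex \<Rightarrow> complex) \<Rightarrow> complex \<Rightarrow> complex" where
  "kdiff p \<nu> y x = p * (\<nu> - x) * (y (x + 1) - y x) + (1 - p) * x * (y (x - 1) - y x)"

lemma kdiff_sum:
  "kdiff p \<nu> (\<lambda>x. \<Sum>k\<in>A. a k * f k x) x = (\<Sum>k\<in>A. a k * kdiff p \<nu> (f k) x)"
  unfolding kdiff_def
  by (induction A rule: infinite_finite_induct) (simp_all add: algebra_simps)

text \<open>Up to one factor, the shifts of \<open>pochhammer (- x) (Suc k)\<close> by 1 and, after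
  multiplication by x, by -1 are multiples of \<open>pochhammer (- x) k\<close>. Hence the operator
  is bidiagonal in the Pochhammer basis, and the coefficients of an eigenfunction obey a two-term
  recurrence.\<close>

lemma kdiff_pochhammer:
  "kdiff p \<nu> (\<lambda>x. pochhammer (- x) (Suc k)) x =
     - of_nat (Suc k) * pochhammer (- x) (Suc k)
     - p * of_nat (Suc k) * (\<nu> - of_nat k) * pochhammer (- x) k"
proof -
  have 1: "pochhammer (- (x + 1)) (Suc k) = (- x - 1) * pochhammer (- x) k"
    by (subst pochhammer_rec) (simp add: algebra_simps)
  have 2: "pochhammer (- x) (Suc k) = pochhammer (- x) k * (- x + of_nat k)"
    by (simp add: pochhammer_Suc)
  have "pochhammer (- x) (Suc k) = (- x) * pochhammer (1 - x) k"
    by (simp add: pochhammer_rec algebra_simps)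
  moreover have 3: "pochhammer (- (x - 1)) (Suc k) = pochhammer (1 - x) k * (1 - x + of_nat k)"
    by (simp add: pochhammer_Suc algebra_simps)
  ultimately have "x * pochhammer (1 - x) k = - pochhammer (- x) k * (- x + of_nat k)"
    using 2 by (metis minus_mult_left minus_minus)
  hence "x * (pochhammer (- (x - 1)) (Suc k) - pochhammer (- x) (Suc k)) =
      (- pochhammer (- x) k * (- x + of_nat k)) * (1 - x + of_nat k) - x * pochhammer (- x) (Suc k)"
    unfolding 3 by (simp add: right_diff_distrib flip: mult.assoc)
  hence 4: "x * (pochhammer (- (x - 1)) (Suc k) - pochhammer (- x) (Suc k)) =
      - pochhammer (- x) k * (- x + of_nat k) * of_nat (Suc k)"
    unfolding 2 by (simp add: algebra_simps)
  have "kdiff p \<nu> (\<lambda>x. pochhammer (- x) (Suc k)) x =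
      p * (\<nu> - x) * (pochhammer (- (x + 1)) (Suc k) - pochhammer (- x) (Suc k)) +
      (1 - p) * (x * (pochhammer (- (x - 1)) (Suc k) - pochhammer (- x) (Suc k)))"
    by (simp add: kdiff_def mult.assoc)
  thus ?thesis
    unfolding 4 1 unfolding 2 by (simp add: algebra_simps)
qed

text \<open>Coefficients are compared in the basis \<phi>. The recurrence \<open>rec\<close> is free
  of division, so it survives the zero factors of
  \<open>pochhammer (- of_nat N + of_nat k) (n - k)\<close> that occur when n > N.\<close>

lemma krawtchouk_eigen:
  "kdiff p (of_nat N) (krawtchouk n p N) x = - of_nat n * krawtchouk n p N x"
proof -
  define a :: "nat \<Rightarrow> complex" where "a k = pochhammer (- of_nat n) k / fact k *
      pochhammer (- of_nat N + of_nat k) (n - k) * p ^ (n - k)" for k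
  define \<phi> :: "nat \<Rightarrow> complex \<Rightarrow> complex" where "\<phi> k x = pochhammer (- x) k" for k x
  define c where "c k = (of_nat n - of_nat k) * a k * \<phi> k x" for k
  have K: "krawtchouk n p N = (\<lambda>x. \<Sum>k=0..n. a k * \<phi> k x)"
    by (auto simp: krawtchouk_def a_def \<phi>_def fun_eq_iff intro!: sum.cong)
  have rec: "(of_nat n - of_nat k) * a k = p * of_nat (Suc k) * (of_nat N - of_nat k) * a (Suc k)"
    if "k < n" for k
  proof -
    define m where "m = n - Suc k"
    have m: "n - k = Suc m" "n - Suc k = m" using that by (auto simp: m_def)
    have 1: "pochhammer (- of_nat N + of_nat k) (Suc m) =
        (- of_nat N + of_nat k) * pochhammer (- of_nat N + of_nat (Suc k) :: complex) m"
      by (subst pochhammer_rec) (simp add: algebra_simps)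
    have "(of_nat n - of_nat k) * a k = - (pochhammer (- of_nat n) k * (- of_nat n + of_nat k) / fact k) *
        ((- of_nat N + of_nat k) * pochhammer (- of_nat N + of_nat (Suc k)) m) * (p * p ^ m)"
      unfolding a_def m 1 power_Suc divide_inverse by algebra
    also have "pochhammer (- of_nat n) k * (- of_nat n + of_nat k) / fact k =
        of_nat (Suc k) * (pochhammer (- of_nat n) (Suc k) / (fact (Suc k) :: complex))"
      by (simp add: pochhammer_Suc del: of_nat_Suc)
    also have "- (of_nat (Suc k) * (pochhammer (- of_nat n) (Suc k) / fact (Suc k))) *
        ((- of_nat N + of_nat k) * pochhammer (- of_nat N + of_nat (Suc k)) m) * (p * p ^ m) =
        p * of_nat (Suc k) * (of_nat N - of_nat k) * a (Suc k)"
      unfolding a_def m divide_inverse by algebra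
    finally show ?thesis .
  qed
  \<comment> \<open>The lower-order part of the operator on \<open>\<phi> k\<close> lands on
    \<open>\<phi> (k - 1)\<close>; by \<open>rec\<close> it is exactly the term c with index k -
    1.\<close>
  have E: "a k * kdiff p (of_nat N) (\<phi> k) x = - of_nat k * a k * \<phi> k x - (case k of 0 \<Rightarrow> 0 | Suc j \<Rightarrow> c j)"
    if "k \<le> n" for k
  proof (cases k)
    case 0
    thus ?thesis by (simp add: kdiff_def \<phi>_def)
  next
    case (Suc j)
    with that have "j < n" by simp
    have "kdiff p (of_nat N) (\<phi> (Suc j)) x = 
         - of_nat (Suc j) * \<phi> (Suc j) x - p * of_nat (Suc j) * (of_nat N - of_nat j) * \<phi> j x"
      unfolding \<phi>_def by (rule kdiff_pochhammer)
    thus ?thesis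
      unfolding Suc c_def nat.case rec[OF \<open>j < n\<close>] by (simp add: right_diff_distrib mult_ac)
  qed
  \<comment> \<open>The shifted sum runs only up to c with index n - 1, but \<open>c n\<close> is
    zero through its factor n - k.\<close>
  have "(\<Sum>k=0..n. case k of 0 \<Rightarrow> 0 | Suc j \<Rightarrow> c j) = (\<Sum>k=0..n. c k)"
  proof (cases n)
    case 0
    thus ?thesis by (simp add: c_def)
  next
    case (Suc m)
    have "(\<Sum>k=0..n. case k of 0 \<Rightarrow> 0 | Suc j \<Rightarrow> c j) = (\<Sum>k=0..m. c k)"
      unfolding Suc by (subst sum.atLeast0_atMost_Suc_shift) simp
    also have "\<dots> = (\<Sum>k=0..n. c k)"
      unfolding Suc by (simp add: c_def Suc)
    finally show ?thesis .
  qed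
  hence "kdiff p (of_nat N) (krawtchouk n p N) x =
      (\<Sum>k=0..n. - of_nat k * a k * \<phi> k x) - (\<Sum>k=0..n. c k)"
    unfolding K kdiff_sum by (simp add: E sum_subtractf)
  also have "\<dots> = (\<Sum>k=0..n. - of_nat n * (a k * \<phi> k x))"
    unfolding sum_subtractf[symmetric] c_def by (intro sum.cong) (auto simp: algebra_simps)
  finally show ?thesis
    unfolding K sum_distrib_left .
qed

lemma fwd_diff_kdiff:
  "fwd_diff (kdiff p \<nu> y) x = kdiff p (\<nu> - 1) (fwd_diff y) x - fwd_diff y x"
  by (simp add: fwd_diff_def kdiff_def algebra_simps)

text \<open>In the commutation rule the extra term \<open>- fwd_diff y x\<close> raises the
  eigenvalue by one per difference. Starting from \<nu> = N, exactly N + 1 differences lead to the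
  parameter -1, whatever N is.\<close>

lemma fwd_diff_eigen:
  assumes "\<And>x. kdiff p \<nu> y x = \<mu> * y x"
  shows   "kdiff p (\<nu> - of_nat k) ((fwd_diff ^^ k) y) x = (\<mu> + of_nat k) * (fwd_diff ^^ k) y x"
proof (induction k arbitrary: x)
  case (Suc k)
  let ?f = "(fwd_diff ^^ k) y"
  have "kdiff p (\<nu> - of_nat k) ?f = (\<lambda>x. (\<mu> + of_nat k) * ?f x)"
    using Suc.IH by blast
  hence "fwd_diff (kdiff p (\<nu> - of_nat k) ?f) x = (\<mu> + of_nat k) * fwd_diff ?f x"
    by (simp add: fwd_diff_def right_diff_distrib)
  with fwd_diff_kdiff[of p "\<nu> - of_nat k" ?f x]
  have "kdiff p (\<nu> - of_nat k - 1) (fwd_diff ?f) x = (\<mu> + of_nat k) * fwd_diff ?f x + fwd_diff ?f x"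
    by simp
  thus ?case
    by (simp add: algebra_simps)
qed (use assms in simp)

section \<open>Symmetry of the operator for the discrete form\<close>

definition casorati :: "(complex \<Rightarrow> complex) \<Rightarrow> (complex \<Rightarrow> complex) \<Rightarrow> complex \<Rightarrow> complex" where
  "casorati y u x = y (x - 1) * u x - y x * u (x - 1)"

text \<open>A discrete Lagrange identity: the products \<open>y x * u x\<close> cancel, and what
  remains are two neighbouring values of the Casoratian, the difference analogue of the
  Wronskian.\<close>

lemma kdiff_casorati:
  "kdiff p \<nu> y x * u x - y x * kdiff p \<nu> u x =
     (1 - p) * x * casorati y u x - p * (\<nu> - x) * casorati y u (x + 1)"
  by (simp add: kdiff_def casorati_def algebra_simps)

text \<open>Multiplied by the weight, the Lagrange identity becomes a difference of consecutive
  values of B, so the sum telescopes; both boundary terms carry a vanishing factor.\<close>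

lemma discrete_form_self_adjoint:
  fixes p :: complex
  shows "discrete_form p N (kdiff p (of_nat N) y) u = discrete_form p N y (kdiff p (of_nat N) u)"
proof -
  define w where "w x = p ^ x * (1 - p) ^ (N - x) /
      (Gamma (of_nat x + 1) * Gamma (of_nat N - of_nat x + 1))" for x
  define B where "B x = w x * (1 - p) * of_nat x * casorati y u (of_nat x)" for x
  \<comment> \<open>The Pearson equation of the binomial weight. It turns the second term of the
    Lagrange identity at x into B at x + 1.\<close>
  have shift: "w x * (p * (of_nat N - of_nat x)) = w (Suc x) * (1 - p) * of_nat (Suc x)"
    if "x < N" for x
  proof -
    define m where "m = N - Suc x"
    have N: "N = x + Suc m" using that by (simp add: m_def)
    have 1: "w x = p ^ x * (1 - p) ^ Suc m / (fact x * fact (Suc m))"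
      unfolding w_def N by (simp add: Gamma_fact [symmetric] add_ac)
    have 2: "w (Suc x) = p ^ Suc x * (1 - p) ^ m / (fact (Suc x) * fact m)"
      unfolding w_def N using Gamma_fact[of "Suc x", where ?'a = complex]
      by (simp add: Gamma_fact [symmetric] add_ac)
    have 3: "of_nat N - of_nat x = (of_nat (Suc m) :: complex)"
      unfolding N by simp
    show ?thesis unfolding 1 2 3 by (simp add: divide_simps del: of_nat_Suc)
  qed
  have "discrete_form p N (kdiff p (of_nat N) y) u - discrete_form p N y (kdiff p (of_nat N) u)
      = (\<Sum>x=0..N. (kdiff p (of_nat N) y (of_nat x) * u (of_nat x) -
                    y (of_nat x) * kdiff p (of_nat N) u (of_nat x)) * w x)"
    unfolding discrete_form_def w_def sum_subtractf[symmetric] left_diff_distrib ..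
  also have "\<dots> = (\<Sum>x=0..N. B x - w x * (p * (of_nat N - of_nat x)) * casorati y u (of_nat (Suc x)))"
    unfolding kdiff_casorati B_def by (intro sum.cong refl) (simp add: algebra_simps)
  \<comment> \<open>At x = N the factor N - x vanishes, hence the cut-off. The only term left after
    telescoping is \<open>B 0\<close>, which vanishes through its factor x.\<close>
  also have "\<dots> = (\<Sum>x=0..N. B x - (if x < N then B (Suc x) else 0))"
    by (intro sum.cong refl) (auto simp: shift B_def)
  also have "\<dots> = (\<Sum>x=0..N. B x) - (\<Sum>x\<in>{0..N}. if x < N then B (Suc x) else 0)"
    by (simp add: sum_subtractf)
  also have "(\<Sum>x\<in>{0..N}. if x < N then B (Suc x) else 0) = (\<Sum>x<N. B (Suc x))"
    by (subst sum.inter_filter [symmetric]) (auto intro!: sum.cong)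
  also have "(\<Sum>x=0..N. B x) - (\<Sum>x<N. B (Suc x)) = B 0"
    by (subst atLeast0AtMost, subst lessThan_Suc_atMost [symmetric], subst sum.lessThan_Suc_shift) simp
  finally show ?thesis by (simp add: B_def)
qed

lemma discrete_form_scale:
  "discrete_form p N (\<lambda>x. c * y x) u = c * discrete_form p N y u"
  "discrete_form p N y (\<lambda>x. c * u x) = c * discrete_form p N y u"
  by (simp_all add: discrete_form_def sum_distrib_left algebra_simps)

lemma discrete_form_krawtchouk:
  assumes "n \<noteq> m"
  shows   "discrete_form p N (krawtchouk n p N) (krawtchouk m p N) = 0"
proof -
  have "kdiff p (of_nat N) (krawtchouk k p N) = (\<lambda>x. - of_nat k * krawtchouk k p N x)" for k
    using krawtchouk_eigen by blast
  hence "- of_nat n * discrete_form p N (krawtchouk n p N) (krawtchouk m p N) =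
      - of_nat m * discrete_form p N (krawtchouk n p N) (krawtchouk m p N)"
    using discrete_form_self_adjoint[of p N "krawtchouk n p N" "krawtchouk m p N"]
    by (simp only: discrete_form_scale)
  with assms show ?thesis by simp
qed

text \<open>The operators act on functions, while \<open>weight_integrable\<close> quantifies over
  formal polynomials; this predicate mediates between the two.\<close>

definition is_poly :: "(complex \<Rightarrow> complex) \<Rightarrow> bool" where
  "is_poly f \<longleftrightarrow> (\<exists>P. f = poly P)"

lemma is_poly_intros:
  "is_poly (\<lambda>x. c)" "is_poly (\<lambda>x. x)"
  "is_poly f \<Longrightarrow> is_poly g \<Longrightarrow> is_poly (\<lambda>x. f x + g x)"
  "is_poly f \<Longrightarrow> is_poly g \<Longrightarrow> is_poly (\<lambda>x. f x - g x)"
  "is_poly f \<Longrightarrow> is_poly g \<Longrightarrow> is_poly (\<lambda>x. f x * g x)"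
  "is_poly f \<Longrightarrow> is_poly (\<lambda>x. f (x + c))"
proof -
  show "is_poly (\<lambda>x. c)"
    unfolding is_poly_def by (intro exI[of _ "[:c:]"]) auto
  show "is_poly (\<lambda>x. x)"
    unfolding is_poly_def by (intro exI[of _ "[:0,1:]"]) auto
  assume "is_poly f"
  then obtain P where P: "f = poly P"
    by (auto simp: is_poly_def)
  show "is_poly (\<lambda>x. f (x + c))"
    unfolding is_poly_def P by (intro exI[of _ "P \<circ>\<^sub>p [:c, 1:]"]) (auto simp: poly_pcompose add.commute)
  assume "is_poly g"
  with P obtain Q where PQ: "f = poly P" "g = poly Q"
    by (auto simp: is_poly_def)
  show "is_poly (\<lambda>x. f x + g x)"
    unfolding is_poly_def PQ by (intro exI[of _ "P + Q"]) auto
  show "is_poly (\<lambda>x. f x - g x)"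
    unfolding is_poly_def PQ by (intro exI[of _ "P - Q"]) auto
  show "is_poly (\<lambda>x. f x * g x)"
    unfolding is_poly_def PQ by (intro exI[of _ "P * Q"]) auto
qed

lemma is_poly_sum: "(\<And>i. i \<in> A \<Longrightarrow> is_poly (f i)) \<Longrightarrow> is_poly (\<lambda>x. \<Sum>i\<in>A. f i x)"
proof (induction A rule: infinite_finite_induct)
  case (insert i A)
  hence "is_poly (\<lambda>x. f i x + (\<Sum>i\<in>A. f i x))"
    by (intro is_poly_intros) auto
  with insert show ?case by simp
qed (simp_all add: is_poly_intros)

lemma is_poly_krawtchouk: "is_poly (krawtchouk n p N)"
proof -
  have "is_poly (\<lambda>x. pochhammer (- x) k)" for k
  proof (induction k)
    case (Suc k)
    have "is_poly (\<lambda>x. pochhammer (- x) k * (of_nat k - x))"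
      by (intro is_poly_intros Suc)
    thus ?case by (simp add: pochhammer_Suc)
  qed (simp add: is_poly_intros)
  moreover have "krawtchouk n p N = (\<lambda>x. \<Sum>k=0..n. (pochhammer (- of_nat n) k / fact k
               * pochhammer (- of_nat N + of_nat k) (n - k) * p ^ (n - k)) * pochhammer (- x) k)"
    by (auto simp: krawtchouk_def fun_eq_iff intro!: sum.cong)
  ultimately show ?thesis
    by (simp only:) (intro is_poly_sum is_poly_intros)
qed

lemma is_poly_fwd_diff: "is_poly f \<Longrightarrow> is_poly ((fwd_diff ^^ k) f)"
proof (induction k)
  case (Suc k)
  hence "is_poly (\<lambda>x. (fwd_diff ^^ k) f (x + 1) - (fwd_diff ^^ k) f x)"
    by (intro is_poly_intros) auto
  thus ?case by (simp add: fwd_diff_def[abs_def])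
qed simp

subsection \<open>Separating contours and winding numbers\<close>

text \<open>The contours run over the whole real line, whereas winding numbers and contour integrals
  refer to paths on the unit interval.\<close>

definition subarc :: "(real \<Rightarrow> complex) \<Rightarrow> real \<Rightarrow> real \<Rightarrow> real \<Rightarrow> complex" where
  "subarc C a b = (\<lambda>x. C ((b - a) * x + a))"

lemma pathstart_subarc [simp]: "pathstart (subarc C a b) = C a"
  and pathfinish_subarc [simp]: "pathfinish (subarc C a b) = C b"
  by (simp_all add: subarc_def pathstart_def pathfinish_def)

lemma path_image_subarc:
  assumes "a < b"
  shows   "path_image (subarc C a b) = C ` {a..b}"
proof -
  have "(\<lambda>x. (b - a) * x + a) ` {0..1} = {a..b}"
    using assms by (simp add: image_affinity_atLeastAtMost)
  moreover have "path_image (subarc C a b) = C ` (\<lambda>x. (b - a) * x + a) ` {0..1}"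
    unfolding path_image_def subarc_def image_image ..
  ultimately show ?thesis by simp
qed

lemma valid_path_subarc:
  assumes C: "C piecewise_C1_differentiable_on UNIV" and "a < b"
  shows   "valid_path (subarc C a b)"
proof -
  have "(C \<circ> (\<lambda>x. (b - a) * x + a)) piecewise_C1_differentiable_on {0..1}"
  proof (rule piecewise_C1_differentiable_compose)
    show "(\<lambda>x. (b - a) * x + a) piecewise_C1_differentiable_on {0..1}"
      by (intro C1_differentiable_imp_piecewise derivative_intros)
    show "C piecewise_C1_differentiable_on (\<lambda>x. (b - a) * x + a) ` {0..1}"
      by (rule piecewise_C1_differentiable_on_subset[OF C]) auto
    fix x
    show "finite ({0..1} \<inter> (\<lambda>x. (b - a) * x + a) -` {x})"
      using assms(2) by (intro finite_Int disjI2 finite_vimageI) (auto simp: inj_on_def)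
  qed
  thus ?thesis
    by (simp add: valid_path_def subarc_def o_def)
qed

text \<open>Affine substitution. The chain rule for the speed may fail only on T, the finite
  preimage of the corners of C, which does not affect the integral.\<close>

lemma contour_integral_subarc:
  assumes C: "C piecewise_C1_differentiable_on UNIV" and "a < b"
    and I: "((\<lambda>t. f (C t) * vector_derivative C (at t)) has_integral I) {a..b}"
  shows   "(f has_contour_integral I) (subarc C a b)"
proof -
  let ?g = "\<lambda>t. f (C t) * vector_derivative C (at t)"
  from C obtain S where S: "finite S" "C C1_differentiable_on (UNIV - S)"
    by (auto simp: piecewise_C1_differentiable_on_def)
  define T where "T = (\<lambda>x. (b - a) * x + a) -` S"
  have fin: "finite T"
    unfolding T_def using assms(2) S(1) by (intro finite_vimageI) (auto simp: inj_on_def)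
  have "((\<lambda>x. ?g ((b - a) *\<^sub>R x + a)) has_integral (I /\<^sub>R (b - a))) {0..1}"
    using has_integral_affinity'[of ?g I a b "b - a" a] assms by auto
  hence "((\<lambda>x. (b - a) *\<^sub>R ?g ((b - a) *\<^sub>R x + a)) has_integral (b - a) *\<^sub>R (I /\<^sub>R (b - a))) {0..1}"
    using has_integral_affinity'[of ?g I a b "b - a" a] assms
    by (intro has_integral_cmul) auto
  hence "((\<lambda>x. (b - a) *\<^sub>R ?g ((b - a) *\<^sub>R x + a)) has_integral I) {0..1}"
    using assms(2) by simp
  moreover have "f (subarc C a b x) * vector_derivative (subarc C a b) (at x) =
      (b - a) *\<^sub>R ?g ((b - a) *\<^sub>R x + a)" if "x \<in> {0..1} - T" for x
  proof -
    have "(b - a) * x + a \<notin> S"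
      using that by (auto simp: T_def)
    hence "C differentiable (at ((b - a) * x + a))"
      using S(2) by (auto simp: C1_differentiable_on_eq)
    hence 1: "(C has_vector_derivative vector_derivative C (at ((b - a) * x + a))) (at ((b - a) * x + a))"
      by (simp add: vector_derivative_works)
    have 2: "((\<lambda>x. (b - a) * x + a) has_vector_derivative (b - a)) (at x)"
      by (auto intro!: derivative_eq_intros simp: has_real_derivative_iff_has_vector_derivative [symmetric])
    have "(subarc C a b has_vector_derivative (b - a) *\<^sub>R vector_derivative C (at ((b - a) * x + a))) (at x)"
      using vector_diff_chain_at[OF 2, of C] 1 by (simp add: o_def subarc_def)
    thus ?thesis
      by (simp add: vector_derivative_at subarc_def)
  qed
  ultimately show ?thesis
    unfolding has_contour_integral by (subst has_integral_spike_finite_eq[OF fin]) auto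
qed

text \<open>
  The function \<open>h\<close> below is continuous with values in \<open>2\<pi>i\<int>\<close> on the connected set \<open>K\<close>.
\<close>

lemma winding_number_Ln:
  fixes M s :: complex
  assumes c: "valid_path c" and K: "connected K" "K \<inter> path_image c = {}" "j \<in> K" "M \<in> K" and s: "s \<noteq> 0"
    and M: "\<And>z. z \<in> path_image c \<Longrightarrow> s * (M - z) \<notin> \<real>\<^sub>\<le>\<^sub>0"
    and K': "\<And>z. z \<in> K \<Longrightarrow> s * (z - pathstart c) \<notin> \<real>\<^sub>\<le>\<^sub>0" "\<And>z. z \<in> K \<Longrightarrow> s * (z - pathfinish c) \<notin> \<real>\<^sub>\<le>\<^sub>0"
  shows "2 * pi * \<i> * winding_number c j = Ln (s * (j - pathfinish c)) - Ln (s * (j - pathstart c))"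
proof -
  define h where "h z = 2 * pi * \<i> * winding_number c z - Ln (s * (z - pathfinish c)) + Ln (s * (z - pathstart c))" for z
  have exp_h: "exp (h z) = 1" if "z \<in> K" for z
  proof -
    have nz: "s * (z - pathfinish c) \<noteq> 0" "s * (z - pathstart c) \<noteq> 0"
      using K'[OF that] by (auto simp del: mult_eq_0_iff)
    have "z \<notin> path_image c" using that K(2) by auto
    from winding_number_exp_2pi[OF _ this] c
    have "pathfinish c - z = exp (2 * pi * \<i> * winding_number c z) * (pathstart c - z)"
      by (simp add: valid_path_imp_path)
    hence *: "z - pathfinish c = exp (2 * pi * \<i> * winding_number c z) * (z - pathstart c)"
      by (simp add: algebra_simps)
    have "exp (h z) = exp (2 * pi * \<i> * winding_number c z) / (s * (z - pathfinish c)) * (s * (z - pathstart c))"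
      unfolding h_def exp_add exp_diff using nz by simp
    also have "\<dots> = 1"
      using nz unfolding * by simp
    finally show ?thesis .
  qed
  have "continuous_on K (winding_number c)"
    using K(2) c by (intro continuous_on_subset[OF continuous_on_winding_number]) (auto simp: valid_path_imp_path)
  hence cont: "continuous_on K h"
    unfolding h_def by (intro continuous_intros K')
  have "h constant_on K"
  proof (rule continuous_discrete_range_constant[OF K(1) cont])
    fix x assume x: "x \<in> K"
    have "1 \<le> norm (h y - h x)" if y: "y \<in> K" "h y \<noteq> h x" for y
    proof -
      have "exp (h y - h x) = 1" using exp_h[OF x] exp_h[OF y(1)] by (simp add: exp_diff)
      then obtain n :: int where "Re (h y - h x) = 0" "Im (h y - h x) = of_int (2 * n) * pi"
        unfolding exp_eq_1 by auto
      hence n: "h y - h x = of_real (of_int (2 * n) * pi) * \<i>"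
        unfolding complex_eq_iff by simp
      with y(2) have "n \<noteq> 0" by auto
      hence "1 \<le> \<bar>real_of_int n\<bar>" by linarith
      moreover have "1 \<le> 2 * pi" using pi_gt3 by simp
      ultimately have "1 * 1 \<le> (2 * pi) * \<bar>real_of_int n\<bar>" by (intro mult_mono) auto
      thus ?thesis unfolding n by (simp add: norm_mult mult_ac)
    qed
    thus "\<exists>e>0. \<forall>y. y \<in> K \<and> h y \<noteq> h x \<longrightarrow> e \<le> norm (h y - h x)"
      by (intro exI[of _ 1]) auto
  qed
  hence "h j = h M"
    using K by (auto simp: constant_on_def)
  \<comment> \<open>Since the path avoids the ray issuing from M, \<open>Ln (s * (M - z))\<close> is
    a primitive of 1 / (z - M) along it, so the winding number about M can be computed
    directly.\<close>
  also have "h M = 0"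
  proof -
    have "M \<notin> path_image c" using K by auto
    hence "((\<lambda>w. 1 / (w - M)) has_contour_integral (2 * pi * \<i> * winding_number c M)) c"
      using c has_contour_integral_winding_number by blast
    moreover have "((\<lambda>w. 1 / (w - M)) has_contour_integral
        Ln (s * (M - pathfinish c)) - Ln (s * (M - pathstart c))) c"
    proof (rule contour_integral_primitive[OF _ c order.refl])
      fix z assume "z \<in> path_image c"
      note z = M[OF this]
      have "s * (M - z) \<noteq> 0" using z by (metis nonpos_Reals_zero_I)
      hence "inverse (s * (M - z)) * (s * (0 - 1)) = 1 / (z - M)"
        by (auto simp: divide_simps)
      moreover have "((\<lambda>z. s * (M - z)) has_field_derivative s * (0 - 1)) (at z)"
        by (auto intro!: derivative_eq_intros)
      from DERIV_chain2[where f = Ln and g = "\<lambda>z. s * (M - z)", OF has_field_derivative_Ln[OF z] this]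
      have "((\<lambda>z. Ln (s * (M - z))) has_field_derivative inverse (s * (M - z)) * (s * (0 - 1))) (at z)" .
      ultimately show "((\<lambda>z. Ln (s * (M - z))) has_field_derivative 1 / (z - M)) (at z within path_image c)"
        using has_field_derivative_at_within by metis
    qed
    ultimately have "2 * pi * \<i> * winding_number c M =
        Ln (s * (M - pathfinish c)) - Ln (s * (M - pathstart c))"
      by (rule has_contour_integral_unique)
    thus "h M = 0" by (simp add: h_def)
  qed
  finally show ?thesis by (simp add: h_def algebra_simps)
qed

text \<open>Both c and d change the same branch of the logarithm between the same two points, in
  opposite directions, so the contributions cancel. The factor s is the choice of the ray: 1 cuts to
  the right (increasing poles), -1 to the left (decreasing poles).\<close>

lemma winding_number_close:
  fixes M s :: complex
  assumes c: "valid_path c" and K: "connected K" "K \<inter> path_image c = {}" "j \<in> K" "M \<in> K" and s: "s \<noteq> 0"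
    and M: "\<And>z. z \<in> path_image c \<Longrightarrow> s * (M - z) \<notin> \<real>\<^sub>\<le>\<^sub>0"
    and K': "\<And>z. z \<in> K \<Longrightarrow> s * (z - pathstart c) \<notin> \<real>\<^sub>\<le>\<^sub>0" "\<And>z. z \<in> K \<Longrightarrow> s * (z - pathfinish c) \<notin> \<real>\<^sub>\<le>\<^sub>0"
    and d: "valid_path d" "pathstart d = pathfinish c" "pathfinish d = pathstart c"
       "\<And>z. z \<in> path_image d \<Longrightarrow> s * (j - z) \<notin> \<real>\<^sub>\<le>\<^sub>0"
  shows "winding_number (c +++ d) j = 0"
proof -
  have jd: "j \<notin> path_image d"
  proof
    assume "j \<in> path_image d"
    from d(4)[OF this] show False by simp
  qed
  have "2 * pi * \<i> * winding_number d j = Ln (s * (j - pathstart c)) - Ln (s * (j - pathfinish c))"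
    using winding_number_Ln[of d "{j}" j j s] d jd s K'[OF K(3)] by simp
  \<comment> \<open>The closing path avoids the ray from j itself, so the previous lemma applies to
    it with the one-point set as K and with M = j.\<close>
  moreover have "2 * pi * \<i> * winding_number c j = Ln (s * (j - pathfinish c)) - Ln (s * (j - pathstart c))"
    by (rule winding_number_Ln[OF c K s M K'])
  ultimately have "2 * pi * \<i> * (winding_number c j + winding_number d j) = 0"
    unfolding distrib_left by simp
  moreover have "winding_number (c +++ d) j = winding_number c j + winding_number d j"
    using K jd d c by (intro winding_number_join) (auto simp: valid_path_imp_path)
  ultimately show ?thesis by simp
qed

section \<open>The complement of a contour, and planes slit along the real axis\<close>

text \<open>As the imaginary part tends to infinity at both ends, only a compact piece of the curve
  comes near a given point. Openness makes components of the complement path components.\<close>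

lemma open_Compl_range:
  fixes C :: "real \<Rightarrow> complex"
  assumes cont: "continuous_on UNIV C"
    and lim: "filterlim (\<lambda>t. Im (C t)) at_bot at_bot" "filterlim (\<lambda>t. Im (C t)) at_top at_top"
  shows "open (- range C)"
proof (subst open_subopen, safe)
  fix z assume z: "z \<notin> range C"
  from lim(1) obtain t1 where t1: "\<And>t. t \<le> t1 \<Longrightarrow> Im (C t) \<le> Im z - 1"
    unfolding filterlim_at_bot eventually_at_bot_linorder by meson
  from lim(2) obtain t2 where t2: "\<And>t. t \<ge> t2 \<Longrightarrow> Im (C t) \<ge> Im z + 1"
    unfolding filterlim_at_top eventually_at_top_linorder by meson
  let ?T = "ball z 1 - C ` {t1..t2}"
  have "compact (C ` {t1..t2})"
    by (intro compact_continuous_image continuous_on_subset[OF cont]) auto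
  hence "open ?T" by (intro open_Diff compact_imp_closed) auto
  moreover have "z \<in> ?T" using z by auto
  moreover have "?T \<subseteq> - range C"
  proof safe
    fix t assume t: "C t \<in> ball z 1" "C t \<notin> C ` {t1..t2}"
    have "\<bar>Im (C t) - Im z\<bar> \<le> dist (C t) z"
      unfolding dist_norm using abs_Im_le_cmod[of "C t - z"] by simp
    also have "\<dots> < 1" using t(1) by (simp add: dist_commute)
    finally have "t1 < t" "t < t2" using t1[of t] t2[of t] by (auto simp: not_le [symmetric])
    with t(2) show False by auto
  qed
  ultimately show "\<exists>T. open T \<and> z \<in> T \<and> T \<subseteq> - range C" by blast
qed

text \<open>The image of a joining path serves as K. Its compactness is what matters later: the ends
  of a long arc of C lie above and below it.\<close>

lemma compact_connected_joining:
  fixes x y :: "'a :: real_normed_vector"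
  assumes "open S" "connected_component S x y"
  shows "\<exists>K. compact K \<and> connected K \<and> K \<subseteq> S \<and> x \<in> K \<and> y \<in> K"
proof -
  have "path_component S x y"
    using assms by (simp add: open_path_connected_component)
  then obtain g where g: "path g" "path_image g \<subseteq> S" "pathstart g = x" "pathfinish g = y"
    by (auto simp: path_component_def)
  thus ?thesis
    by (intro exI[of _ "path_image g"]) (auto intro: compact_path_image connected_path_image)
qed

text \<open>The domain of the primitive F: the real axis may be crossed only in the gap between the
  last decreasing and the first increasing pole.\<close>

definition cut_plane :: "complex set" where
  "cut_plane = - {z. Im z = 0 \<and> (Re z \<le> -1 \<or> Re z \<ge> 0)}"

text \<open>Used with R = 1 as domain of the regularised function g, and with larger R as a simply
  connected region holding a closed path and only finitely many poles.\<close>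

definition slit_plane :: "real \<Rightarrow> complex set" where
  "slit_plane R = - {z. Im z = 0 \<and> \<bar>Re z\<bar> \<ge> R}"

lemma open_slit_plane: "open (slit_plane R)"
proof -
  have "- slit_plane R = {z. Im z = 0} \<inter> {z. \<bar>Re z\<bar> \<ge> R}" by (auto simp: slit_plane_def)
  hence "closed (- slit_plane R)"
    by (auto intro!: closed_Int closed_Collect_eq closed_Collect_le continuous_intros)
  thus ?thesis by (simp add: closed_def)
qed

lemma starlike_slit_plane:
  assumes "R > 0"
  shows   "starlike (slit_plane R)"
  unfolding starlike_def
proof (intro bexI[of _ 0] ballI subsetI)
  fix x z :: complex assume x: "x \<in> slit_plane R" and z: "z \<in> closed_segment 0 x"
  then obtain u where u: "0 \<le> u" "u \<le> 1" "z = u *\<^sub>R x"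
    by (auto simp: closed_segment_def)
  show "z \<in> slit_plane R"
  proof (rule ccontr)
    assume "z \<notin> slit_plane R"
    hence "u * Im x = 0" "R \<le> u * \<bar>Re x\<bar>" using u by (auto simp: slit_plane_def abs_mult)
    moreover have "u * \<bar>Re x\<bar> \<le> 1 * \<bar>Re x\<bar>" using u by (intro mult_right_mono) auto
    ultimately show False using x u assms by (auto simp: slit_plane_def)
  qed
qed (use assms in \<open>auto simp: slit_plane_def\<close>)

text \<open>The relation \<open>connected_component S\<close> is reflexive only on S, so a pole
  related to itself must lie off the curve.\<close>

lemma separating_contour_avoids_Ints:
  assumes "separating_contour C"
  shows   "C t \<notin> \<int>"
proof
  assume "C t \<in> \<int>"
  then obtain i where i: "C t = of_int i" by (auto elim: Ints_cases)
  have "connected_component (- range C) (of_int i) (of_int i)"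
  proof (cases "i \<ge> 0")
    case True
    hence "of_int i \<in> increasing_poles"
      unfolding increasing_poles_def by (metis of_int_of_nat_eq nonneg_int_cases rangeI)
    thus ?thesis using assms unfolding separating_contour_def by blast
  next
    case False
    then obtain k where "i = - int (Suc k)" by (cases i rule: int_cases) auto
    hence "of_int i \<in> decreasing_poles"
      unfolding decreasing_poles_def by simp
    thus ?thesis using assms unfolding separating_contour_def by blast
  qed
  from connected_component_in(1)[OF this] i show False by (metis ComplD rangeI)
qed

text \<open>The arc c need not stay in \<open>cut_plane\<close>, but closing it by a path d through
  the gap gives zero winding number about every integer. By the residue theorem the closed integral
  is zero whatever the residues are, and along d the function F is a primitive.\<close>

lemma contour_integral_subarc_primitive:
  assumes sep: "separating_contour C" and G: "G holomorphic_on - \<int>"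
    and F: "\<And>z. z \<in> cut_plane \<Longrightarrow> (F has_field_derivative G z) (at z)"
  shows "\<exists>T>0. \<forall>a b. a \<le> -T \<and> b \<ge> T \<longrightarrow> contour_integral (subarc C a b) G = F (C b) - F (C a)"
proof -
  from sep have pC: "C piecewise_C1_differentiable_on UNIV"
    and lim: "filterlim (\<lambda>t. Im (C t)) at_bot at_bot" "filterlim (\<lambda>t. Im (C t)) at_top at_top"
    by (auto simp: separating_contour_def)
  have cont: "continuous_on UNIV C" using pC by (simp add: piecewise_C1_differentiable_on_def)
  have op: "open (- range C)" by (rule open_Compl_range) fact+
  \<comment> \<open>The curve meets the real axis in a bounded set. Beyond M on the right and beyond
    -M on the left, the axis is free of it.\<close>
  obtain M :: nat where M: "\<And>t. Im (C t) = 0 \<Longrightarrow> \<bar>Re (C t)\<bar> < real M"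
  proof -
    from lim(1) obtain t1 where t1: "\<And>t. t \<le> t1 \<Longrightarrow> Im (C t) \<le> - 1"
      unfolding filterlim_at_bot eventually_at_bot_linorder by meson
    from lim(2) obtain t2 where t2: "\<And>t. t \<ge> t2 \<Longrightarrow> Im (C t) \<ge> 1"
      unfolding filterlim_at_top eventually_at_top_linorder by meson
    have "compact (C ` {t1..t2})"
      by (intro compact_continuous_image continuous_on_subset[OF cont]) auto
    then obtain B where B: "\<And>t. t \<in> {t1..t2} \<Longrightarrow> norm (C t) \<le> B"
      using compact_imp_bounded bounded_iff by (metis imageI)
    obtain M :: nat where "B < real M" using reals_Archimedean2 by blast
    moreover have "t \<in> {t1..t2}" if "Im (C t) = 0" for t
      using t1[of t] t2[of t] that by force
    ultimately show ?thesis using abs_Re_le_cmod B that by (meson le_less_trans)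
  qed
  \<comment> \<open>The separation hypothesis provides links, off the curve, from each increasing
    pole to the reference pole M; below, each decreasing pole is linked to the reference pole -(M +
    1).\<close>
  have "\<forall>k. \<exists>K. compact K \<and> connected K \<and> K \<subseteq> - range C \<and> of_nat k \<in> K \<and> of_nat M \<in> K"
    using sep by (auto intro!: compact_connected_joining[OF op] simp: separating_contour_def increasing_poles_def)
  then obtain K1 where K1: "\<And>k. compact (K1 k)" "\<And>k. connected (K1 k)" "\<And>k. K1 k \<subseteq> - range C"
    "\<And>k. of_nat k \<in> K1 k" "\<And>k. of_nat M \<in> K1 k" by metis
  have "\<forall>k. \<exists>K. compact K \<and> connected K \<and> K \<subseteq> - range C \<and> - of_nat (Suc k) \<in> K \<and> - of_nat (Suc M) \<in> K"
    using sep unfolding separating_contour_def decreasing_poles_def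
    by (intro allI compact_connected_joining[OF op]) blast
  then obtain K2 where K2: "\<And>k. compact (K2 k)" "\<And>k. connected (K2 k)" "\<And>k. K2 k \<subseteq> - range C"
    "\<And>k. - of_nat (Suc k) \<in> K2 k" "\<And>k. - of_nat (Suc M) \<in> K2 k" by metis
  \<comment> \<open>Finitely many links suffice, so one R bounds them all. Arcs whose ends have
    imaginary part beyond R in modulus start below and finish above every link.\<close>
  have "compact (\<Union>k\<le>M. K1 k \<union> K2 k)"
    using K1(1) K2(1) by (intro compact_UN compact_Un) auto
  then obtain R where R: "\<And>z. z \<in> (\<Union>k\<le>M. K1 k \<union> K2 k) \<Longrightarrow> norm z \<le> R"
    using compact_imp_bounded bounded_iff by metis
  from lim(1) obtain t1 where t1: "\<And>t. t \<le> t1 \<Longrightarrow> Im (C t) \<le> - \<bar>R\<bar> - 1"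
    unfolding filterlim_at_bot eventually_at_bot_linorder by meson
  from lim(2) obtain t2 where t2: "\<And>t. t \<ge> t2 \<Longrightarrow> Im (C t) \<ge> \<bar>R\<bar> + 1"
    unfolding filterlim_at_top eventually_at_top_linorder by meson
  define T where "T = max 1 (max (-t1) t2)"
  have "contour_integral (subarc C a b) G = F (C b) - F (C a)" if ab: "a \<le> -T" "b \<ge> T" for a b
  proof -
    define c where "c = subarc C a b"
    \<comment> \<open>The detour through -1/2 crosses the real axis inside the gap.\<close>
    define d where "d = linepath (C b) (-1/2) +++ linepath (-1/2) (C a)"
    have "a < b" using ab by (auto simp: T_def)
    have Ca: "Im (C a) \<le> - \<bar>R\<bar> - 1" and Cb: "Im (C b) \<ge> \<bar>R\<bar> + 1"
      using ab by (auto intro!: t1 t2 simp: T_def)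
    have c: "valid_path c" unfolding c_def by (intro valid_path_subarc) fact+
    have d: "valid_path d" by (simp add: d_def)
    have pic: "path_image c \<subseteq> range C"
      unfolding c_def using \<open>a < b\<close> by (auto simp: path_image_subarc)
    have seg: "closed_segment w (-1/2) \<subseteq> cut_plane" if "Im w \<noteq> 0" for w
    proof
      fix z assume "z \<in> closed_segment w (-1/2)"
      then obtain u where u: "0 \<le> u" "u \<le> 1" "z = (1 - u) *\<^sub>R w + u *\<^sub>R (-1/2)"
        by (auto simp: closed_segment_def)
      show "z \<in> cut_plane"
      proof (cases "u = 1")
        case True
        thus ?thesis using u by (simp add: cut_plane_def)
      next
        case False
        hence "Im z \<noteq> 0" using that u by simp
        thus ?thesis by (simp add: cut_plane_def)
      qed
    qed
    have pid: "path_image d \<subseteq> cut_plane"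
      using seg[of "C b"] seg[of "C a"] Ca Cb
      unfolding d_def by (subst path_image_join) (auto simp: closed_segment_commute)
    have [simp]: "pathstart d = C b" "pathfinish d = C a" "pathstart c = C a" "pathfinish c = C b"
      by (simp_all add: d_def c_def)
    \<comment> \<open>This starlike region contains c and d, and its only integers are those of
      modulus at most M.\<close>
    define S where "S = slit_plane (real M + 1)"
    note S_def = S_def [unfolded slit_plane_def]
    have opS: "open S" and star: "starlike S"
      unfolding S_def [folded slit_plane_def] by (auto intro: open_slit_plane starlike_slit_plane)
    define pts :: "complex set" where "pts = of_int ` {-int (Suc M)<..<int (Suc M)}"
    have "Ints \<inter> cut_plane = {}"
      by (auto simp: cut_plane_def elim!: Ints_cases)
    hence noint: "path_image (c +++ d) \<subseteq> - \<int>"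
      using pic pid separating_contour_avoids_Ints[OF sep] by (subst path_image_join) auto
    have "cut_plane \<subseteq> S" by (auto simp: cut_plane_def S_def)
    have 1: "path_image (c +++ d) \<subseteq> S"
    proof (subst path_image_join; safe?)
      fix z assume "z \<in> path_image d" thus "z \<in> S"
        using pid \<open>cut_plane \<subseteq> S\<close> by auto
    next
      fix z assume "z \<in> path_image c"
      then obtain t where "z = C t" using pic by auto
      thus "z \<in> S" using M[of t] by (auto simp: S_def)
    qed simp
    have "contour_integral (c +++ d) G = 2 * pi * \<i> * (\<Sum>p\<in>pts. winding_number (c +++ d) p * residue G p)"
    proof (rule Residue_theorem[OF opS])
      show "connected S" using star by (rule starlike_imp_connected)
      show "finite pts" by (simp add: pts_def)
      have "S - pts \<subseteq> - \<int>"
      proof safe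
        fix z :: complex assume z: "z \<in> S" "z \<notin> pts" "z \<in> \<int>"
        then obtain i where i: "z = of_int i" by (auto elim: Ints_cases)
        with z(2) have "\<not> (-int (Suc M) < i \<and> i < int (Suc M))" by (auto simp: pts_def)
        hence "int M + 1 \<le> \<bar>i\<bar>" by auto
        hence "real M + 1 \<le> \<bar>real_of_int i\<bar>" by linarith
        with z(1) i show False by (simp add: S_def)
      qed
      thus "G holomorphic_on S - pts" using G holomorphic_on_subset by blast
      show "valid_path (c +++ d)" using c d by auto
      have "pts \<subseteq> \<int>" by (auto simp: pts_def)
      thus "path_image (c +++ d) \<subseteq> S - pts" using 1 noint by auto
      show "\<forall>z. z \<notin> S \<longrightarrow> winding_number (c +++ d) z = 0"
        using simply_connected_imp_winding_number_zero[OF starlike_imp_simply_connected[OF star] _ 1] c d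
        by (auto simp: valid_path_imp_path)
    qed simp
    also have "(\<Sum>p\<in>pts. winding_number (c +++ d) p * residue G p) = 0"
    proof (rule sum.neutral, safe)
      fix j assume "j \<in> pts"
      then obtain i where i: "j = of_int i" "-int (Suc M) < i" "i < int (Suc M)" by (auto simp: pts_def)
      have Kab: "Im (z - C a) \<noteq> 0 \<and> Im (z - C b) \<noteq> 0" if "z \<in> K1 k \<union> K2 k" "k \<le> M" for z k
      proof -
        have "norm z \<le> R" using R that by auto
        thus ?thesis using Ca Cb abs_Im_le_cmod[of z] by auto
      qed
      have "winding_number (c +++ d) j = 0"
      proof (cases "i \<ge> 0")
        case True
        \<comment> \<open>Increasing pole: rays point to the right. The endpoints of c avoid the
          rays from the link because their imaginary parts differ from those on the link.\<close>
        define k where "k = nat i"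
        have k: "j = of_nat k" "k \<le> M" using True i by (auto simp: k_def)
        show ?thesis
        proof (rule winding_number_close[of c "K1 k" j "of_nat M" 1])
          fix z assume "z \<in> path_image c"
          then obtain t where "z = C t" using pic by auto
          thus "1 * (of_nat M - z) \<notin> \<real>\<^sub>\<le>\<^sub>0" using M[of t] by (auto simp: complex_nonpos_Reals_iff)
        next
          fix z assume "z \<in> path_image d"
          thus "1 * (j - z) \<notin> \<real>\<^sub>\<le>\<^sub>0" using pid k by (auto simp: complex_nonpos_Reals_iff cut_plane_def)
        next
          fix z assume "z \<in> K1 k"
          hence "Im (z - C a) \<noteq> 0 \<and> Im (z - C b) \<noteq> 0" using Kab k(2) by blast
          thus "1 * (z - pathstart c) \<notin> \<real>\<^sub>\<le>\<^sub>0" "1 * (z - pathfinish c) \<notin> \<real>\<^sub>\<le>\<^sub>0"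
            by (auto simp: complex_nonpos_Reals_iff)
        next
          show "K1 k \<inter> path_image c = {}" using K1(3)[of k] pic by blast
          show "j \<in> K1 k" "of_nat M \<in> K1 k" unfolding k(1) by (rule K1)+
        qed (use c d K1(2) in auto)
      next
        case False
        \<comment> \<open>Decreasing pole: the mirror image with s = -1. The index is shifted by one
          because these poles start at -1.\<close>
        define k where "k = nat (-i) - 1"
        have "i = - int (Suc k)" "k \<le> M" using False i by (auto simp: k_def)
        hence k: "j = - of_nat (Suc k)" "k \<le> M" using i by auto
        show ?thesis
        proof (rule winding_number_close[of c "K2 k" j "- of_nat (Suc M)" "-1"])
          fix z assume "z \<in> path_image c"
          then obtain t where "z = C t" using pic by auto
          thus "(-1) * (- of_nat (Suc M) - z) \<notin> \<real>\<^sub>\<le>\<^sub>0" using M[of t] by (auto simp: complex_nonpos_Reals_iff)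
        next
          fix z assume "z \<in> path_image d"
          thus "(-1) * (j - z) \<notin> \<real>\<^sub>\<le>\<^sub>0" using pid k by (auto simp: complex_nonpos_Reals_iff cut_plane_def)
        next
          fix z assume "z \<in> K2 k"
          hence "Im (z - C a) \<noteq> 0 \<and> Im (z - C b) \<noteq> 0" using Kab k(2) by blast
          thus "(-1) * (z - pathstart c) \<notin> \<real>\<^sub>\<le>\<^sub>0" "(-1) * (z - pathfinish c) \<notin> \<real>\<^sub>\<le>\<^sub>0"
            by (auto simp: complex_nonpos_Reals_iff)
        next
          show "K2 k \<inter> path_image c = {}" using K2(3)[of k] pic by blast
          show "j \<in> K2 k" "- of_nat (Suc M) \<in> K2 k" unfolding k(1) by (rule K2)+
        qed (use c d K2(2) in auto)
      qed
      thus "winding_number (c +++ d) j * residue G j = 0" by simp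
    qed
    finally have "contour_integral (c +++ d) G = 0" by simp
    moreover have "contour_integral (c +++ d) G = contour_integral c G + contour_integral d G"
    proof (rule contour_integral_join)
      show "G contour_integrable_on c" "G contour_integrable_on d"
        using noint c d
        by (auto intro!: contour_integrable_holomorphic_simple[OF G] simp: path_image_join)
    qed (use c d in auto)
    moreover have "contour_integral d G = F (C a) - F (C b)"
      using contour_integral_primitive[of cut_plane F G d] F pid d
      by (auto intro!: contour_integral_unique intro: has_field_derivative_at_within)
    ultimately have "contour_integral c G = F (C b) - F (C a)"
      by algebra
    thus ?thesis by (simp add: c_def)
  qed
  moreover have "T > 0" by (simp add: T_def)
  ultimately show ?thesis by blast
qed

subsection \<open>The weight function\<close>

text \<open>With v = exp |Im z| the squared modulus of the sine is (v^2 + v^(-2) - 2 cos(2 Re z)) /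
  4; this bound and the next one estimate the last two terms crudely, uniformly in Re z.\<close>

lemma norm_sin_le: "norm (sin z) \<le> exp \<bar>Im z\<bar>" for z :: complex
proof (rule power2_le_imp_le)
  define v where "v = exp \<bar>Im z\<bar>"
  have v: "v \<ge> 1" by (simp add: v_def)
  have "exp (2 * Im z) + inverse (exp (2 * Im z)) = v\<^sup>2 + inverse (v\<^sup>2)"
    by (cases "Im z \<ge> 0") (auto simp: v_def exp_double exp_minus power_inverse add.commute)
  hence "norm (sin z) ^ 2 = (v\<^sup>2 + inverse (v\<^sup>2) - 2 * cos (2 * Re z)) / 4"
    by (subst norm_sin_squared) simp
  also have "\<dots> \<le> (v\<^sup>2 + 1 + 2 * 1) / 4"
  proof -
    have "inverse (v\<^sup>2) \<le> 1" using v by (simp add: inverse_le_1_iff)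
    moreover have "-1 \<le> cos (2 * Re z)" by simp
    ultimately show ?thesis by (intro divide_right_mono) linarith+
  qed
  also have "\<dots> \<le> v\<^sup>2"
    using v one_le_power[of v 2] by simp
  finally show "norm (sin z) ^ 2 \<le> exp \<bar>Im z\<bar> ^ 2" by (simp add: v_def)
qed simp

text \<open>The hypothesis gives v >= 2, which keeps z away from the real zeros and makes the
  leading term dominate.\<close>

lemma norm_sin_ge:
  fixes z :: complex
  assumes "\<bar>Im z\<bar> \<ge> 1"
  shows   "exp \<bar>Im z\<bar> / 4 \<le> norm (sin z)"
proof (rule power2_le_imp_le)
  define v where "v = exp \<bar>Im z\<bar>"
  have "v \<ge> 2" using exp_ge_add_one_self[of "\<bar>Im z\<bar>"] assms unfolding v_def by linarith
  hence v: "v\<^sup>2 \<ge> 4" using power_mono[of 2 v 2] by simp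
  have "exp (2 * Im z) + inverse (exp (2 * Im z)) = v\<^sup>2 + inverse (v\<^sup>2)"
    by (cases "Im z \<ge> 0") (auto simp: v_def exp_double exp_minus power_inverse add.commute)
  hence *: "norm (sin z) ^ 2 = (v\<^sup>2 + inverse (v\<^sup>2) - 2 * cos (2 * Re z)) / 4"
    by (subst norm_sin_squared) simp
  have "0 \<le> inverse (v\<^sup>2)" "cos (2 * Re z) \<le> 1" by simp_all
  hence "norm (sin z) ^ 2 \<ge> (v\<^sup>2 - 2) / 4"
    unfolding * by (intro divide_right_mono) linarith+
  also have "(v\<^sup>2 - 2) / 4 \<ge> (v / 4) ^ 2"
    using v by (simp add: power_divide)
  finally show "(exp \<bar>Im z\<bar> / 4) ^ 2 \<le> norm (sin z) ^ 2" by (simp add: v_def)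
qed simp

text \<open>Euler's reflection formula. It needs no exception at the integers, where both sides are
  0 by the conventions for Gamma at a pole and for division by zero.\<close>

lemma cont_weight_sin:
  "cont_weight p z = - of_real pi / sin (of_real pi * z) * (p / (1 - p)) powr z"
  using Gamma_reflection_complex[of "-z"] by (simp add: cont_weight_def)

lemma cont_weight_plus1:
  assumes "p \<noteq> 0" "p \<noteq> 1"
  shows   "cont_weight p (z + 1) = - (p / (1 - p)) * cont_weight p z"
proof -
  have "sin (of_real pi * (z + 1)) = - sin (of_real pi * z)"
    by (simp add: ring_distribs sin_plus_pi)
  moreover have "(p / (1 - p)) powr (z + 1) = (p / (1 - p)) powr z * (p / (1 - p))"
    using assms by (simp add: powr_add)
  ultimately show ?thesis by (simp add: cont_weight_sin mult_ac)
qed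

lemma not_Ints_imp_not_nonpos_Ints:
  fixes z :: complex
  assumes "z \<notin> \<int>"
  shows   "- z \<notin> \<int>\<^sub>\<le>\<^sub>0" "1 + z \<notin> \<int>\<^sub>\<le>\<^sub>0"
  using assms by (auto dest!: subsetD[OF nonpos_Ints_subset_Ints] simp: minus_in_Ints_iff)

lemma holomorphic_cont_weight:
  assumes "p \<noteq> 0" "p \<noteq> 1"
  shows   "cont_weight p holomorphic_on - \<int>"
  unfolding cont_weight_def[abs_def]
  using assms not_Ints_imp_not_nonpos_Ints by (intro holomorphic_intros) auto

lemma cont_weight_nonzero:
  assumes "p \<noteq> 0" "p \<noteq> 1" "z \<notin> \<int>"
  shows   "cont_weight p z \<noteq> 0"
  using assms not_Ints_imp_not_nonpos_Ints[of z] by (simp add: cont_weight_def Gamma_eq_zero_iff)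

text \<open>A horizontal shift leaves the imaginary part alone, so the two sine bounds compare the
  sines up to the factor 4, while the power changes by |p / (1 - p)|^s, at most 1 + |p / (1 -
  p)|.\<close>

lemma norm_cont_weight_shift:
  assumes "p \<noteq> 0" "p \<noteq> 1" "\<bar>Im z\<bar> \<ge> 1" "0 \<le> s" "s \<le> 1"
  shows   "norm (cont_weight p (z + of_real s)) \<le> 4 * (1 + norm (p / (1 - p))) * norm (cont_weight p z)"
proof -
  define \<rho> where "\<rho> = p / (1 - p)"
  have \<rho>: "norm \<rho> > 0" using assms by (simp add: \<rho>_def)
  have "1 \<le> pi * \<bar>Im z\<bar>" using pi_gt3 assms(3) mult_mono[of 1 pi 1 "\<bar>Im z\<bar>"] by simp
  hence im: "\<bar>Im (of_real pi * (z + of_real s))\<bar> \<ge> 1" "\<bar>Im (of_real pi * z)\<bar> \<ge> 1" by (auto simp: abs_mult)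
  have "norm (sin (of_real pi * z)) \<le> exp \<bar>Im (of_real pi * z)\<bar>" by (rule norm_sin_le)
  also have "\<dots> \<le> 4 * norm (sin (of_real pi * (z + of_real s)))"
    using norm_sin_ge[OF im(1)] by simp
  finally have sn: "norm (sin (of_real pi * z)) \<le> 4 * norm (sin (of_real pi * (z + of_real s)))" .
  have "exp \<bar>Im (of_real pi * z)\<bar> / 4 > 0" by simp
  hence pos: "norm (sin (of_real pi * z)) > 0" using norm_sin_ge[OF im(2)] by linarith
  have "norm \<rho> powr s \<le> 1 + norm \<rho>"
  proof (cases "norm \<rho> \<le> 1")
    case True
    hence "norm \<rho> powr s \<le> 1" using assms by (intro powr_le1) auto
    thus ?thesis using \<rho> by linarith
  next
    case False
    hence "norm \<rho> powr s \<le> norm \<rho> powr 1" using assms by (intro powr_mono) auto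
    thus ?thesis using \<rho> by simp
  qed
  moreover have "norm (cont_weight p (z + of_real s)) =
      pi / norm (sin (of_real pi * (z + of_real s))) * (norm (\<rho> powr z) * norm \<rho> powr s)"
    by (simp add: cont_weight_sin \<rho>_def[symmetric] norm_mult norm_divide powr_add norm_powr_real_powr')
  ultimately have "norm (cont_weight p (z + of_real s)) \<le>
      pi / (norm (sin (of_real pi * z)) / 4) * (norm (\<rho> powr z) * (1 + norm \<rho>))"
    using sn pos
    by (simp only:) (intro mult_mono divide_left_mono mult_pos_pos, auto)
  also have "\<dots> = 4 * (1 + norm \<rho>) * norm (cont_weight p z)"
    unfolding cont_weight_sin \<rho>_def[symmetric] norm_mult norm_divide by simp
  finally show ?thesis by (simp add: \<rho>_def)
qed

lemma norm_poly_le: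
  fixes P :: "complex poly"
  shows "\<exists>A\<ge>0. \<exists>d. \<forall>z. norm (poly P z) \<le> A * (1 + norm z) ^ d"
proof (induction P)
  case 0
  show ?case by (intro exI[of _ 0]) auto
next
  case (pCons a P)
  then obtain A d where A: "A \<ge> 0" "\<And>z. norm (poly P z) \<le> A * (1 + norm z) ^ d" by auto
  have "norm (poly (pCons a P) z) \<le> (norm a + A) * (1 + norm z) ^ Suc d" for z
  proof -
    have "norm (poly (pCons a P) z) \<le> norm a + norm z * norm (poly P z)"
      by (simp add: norm_triangle_le norm_mult)
    also have "\<dots> \<le> norm a * (1 + norm z) ^ Suc d + (1 + norm z) * (A * (1 + norm z) ^ d)"
      using A mult_left_mono[OF one_le_power[of "1 + norm z" "Suc d"], of "norm a"]
      by (intro add_mono mult_mono) auto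
    finally show ?thesis by (simp add: algebra_simps)
  qed
  moreover have "0 \<le> norm a + A" using A(1) by simp
  ultimately show ?case by blast
qed

text \<open>The right-hand side of \<open>kdiff_casorati\<close> at \<nu> = -1, with q in place of
  the Casoratian.\<close>

definition shift_op :: "complex \<Rightarrow> (complex \<Rightarrow> complex) \<Rightarrow> complex \<Rightarrow> complex" where
  "shift_op p q z = p * (z + 1) * q (z + 1) + (1 - p) * z * q z"

text \<open>If H is a primitive of g, then H(z + 1) - H(z) is a primitive of g(z + 1) - g(z), and
  the mean value inequality on the unit segment bounds it by the size of g there.\<close>

lemma shift_op_primitive:
  assumes p: "p \<noteq> 0" "p \<noteq> 1"
  obtains F K d where
    "\<And>z. z \<in> cut_plane \<Longrightarrow> (F has_field_derivative shift_op p (poly q) z * cont_weight p z) (at z)"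
    "K \<ge> 0" "\<And>z. \<bar>Im z\<bar> \<ge> 1 \<Longrightarrow> norm (F z) \<le> K * ((1 + norm z) ^ d * norm (cont_weight p z))"
proof -
  define \<rho> where "\<rho> = p / (1 - p)"
  have \<rho>: "\<rho> \<noteq> 0" using p by (simp add: \<rho>_def)
  \<comment> \<open>Writing Gamma (1 - z) for -z Gamma (-z) removes the pole at 0. Then g is
    holomorphic between -1 and 1, which is where z and z + 1 can lie on the real axis when z is in
    \<open>cut_plane\<close>.\<close>
  define g where "g z = (1 - p) * poly q z * (Gamma (1 - z) * Gamma (1 + z)) * \<rho> powr z" for z
  have g_eq: "g z = - ((1 - p) * z * poly q z * cont_weight p z)" if "z \<notin> \<int>" for z
  proof -
    have "-z \<notin> \<int>\<^sub>\<le>\<^sub>0" using that by (auto dest!: subsetD[OF nonpos_Ints_subset_Ints] simp: minus_in_Ints_iff)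
    hence "Gamma (1 - z) = - z * Gamma (- z)" using Gamma_plus1[of "-z"] by simp
    thus ?thesis by (simp add: g_def cont_weight_def \<rho>_def)
  qed
  have "1 - z \<notin> \<int>\<^sub>\<le>\<^sub>0" "1 + z \<notin> \<int>\<^sub>\<le>\<^sub>0" if "z \<in> slit_plane 1" for z
    using that by (auto simp: slit_plane_def complex_eq_iff elim!: nonpos_Ints_cases)
  hence hol: "g holomorphic_on slit_plane 1"
    unfolding g_def using \<rho> by (intro holomorphic_intros) auto
  obtain H where H: "\<And>z. z \<in> slit_plane 1 \<Longrightarrow> (H has_field_derivative g z) (at z)"
    using holomorphic_starlike_primitive[OF holomorphic_on_imp_continuous_on[OF hol]
        starlike_slit_plane open_slit_plane finite.emptyI] hol open_slit_plane[of 1]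
    by (auto simp: holomorphic_on_open field_differentiable_def)
  define F where "F z = H (z + 1) - H z" for z
  have "(F has_field_derivative shift_op p (poly q) z * cont_weight p z) (at z)" if "z \<in> cut_plane" for z
  proof -
    have "z \<in> slit_plane 1" "z + 1 \<in> slit_plane 1"
      using that by (auto simp: slit_plane_def cut_plane_def)
    hence D: "(F has_field_derivative g (z + 1) - g z) (at z)"
      unfolding F_def by (intro DERIV_diff DERIV_shift[THEN iffD1, OF H] H)
    have "z \<notin> \<int>" using that by (auto simp: cut_plane_def elim!: Ints_cases)
    moreover have "z + 1 \<notin> \<int>" using that by (auto simp: cut_plane_def complex_eq_iff elim!: Ints_cases)
    ultimately have "g (z + 1) = - ((1 - p) * (z + 1) * poly q (z + 1) * (- \<rho> * cont_weight p z))"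
        "g z = - ((1 - p) * z * poly q z * cont_weight p z)"
      using g_eq[of z] g_eq[of "z + 1"] unfolding cont_weight_plus1[OF p, folded \<rho>_def] by blast+
    hence "g (z + 1) - g z = ((1 - p) * \<rho> * (z + 1) * poly q (z + 1) + (1 - p) * z * poly q z) * cont_weight p z"
      by algebra
    also have "(1 - p) * \<rho> = p" using p by (simp add: \<rho>_def)
    finally show ?thesis using D by (simp add: shift_op_def)
  qed
  moreover obtain A d where A: "A \<ge> 0" "\<And>z. norm (poly (smult (1 - p) (pCons 0 q)) z) \<le> A * (1 + norm z) ^ d"
    using norm_poly_le[of "smult (1 - p) (pCons 0 q)"] by auto
  \<comment> \<open>The factor 2^d accounts for 1 + |w| <= 2 (1 + |z|) on the segment from z to z +
    1, the last factor for the change of the weight along it.\<close>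
  define K where "K = A * 2 ^ d * (4 * (1 + norm \<rho>))"
  have "K \<ge> 0" using A by (simp add: K_def)
  moreover have "norm (F z) \<le> K * ((1 + norm z) ^ d * norm (cont_weight p z))" if z: "\<bar>Im z\<bar> \<ge> 1" for z
  proof -
    have "norm (H (z + 1) - H z) \<le> K * ((1 + norm z) ^ d * norm (cont_weight p z)) * norm ((z + 1) - z)"
    proof (rule field_differentiable_bound)
      show "convex (closed_segment z (z + 1))" by simp
      fix w assume "w \<in> closed_segment z (z + 1)"
      then obtain s where s: "0 \<le> s" "s \<le> 1" "w = z + of_real s"
        by (auto simp: closed_segment_def scaleR_conv_of_real algebra_simps)
      hence w: "Im w = Im z" by simp
      have "w \<in> slit_plane 1" using z w by (auto simp: slit_plane_def)
      thus "(H has_field_derivative g w) (at w within closed_segment z (z + 1))"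
        using H has_field_derivative_at_within by blast
      have "w \<notin> \<int>" using z w by (auto elim!: Ints_cases)
      hence "norm (g w) = norm (poly (smult (1 - p) (pCons 0 q)) w) * norm (cont_weight p w)"
        by (simp add: g_eq norm_mult)
      also have "\<dots> \<le> (A * (1 + norm w) ^ d) * (4 * (1 + norm \<rho>) * norm (cont_weight p z))"
        using norm_cont_weight_shift[OF p z s(1,2)] A unfolding s(3)[symmetric] \<rho>_def
        by (intro mult_mono) auto
      also have "\<dots> \<le> (A * (2 * (1 + norm z)) ^ d) * (4 * (1 + norm \<rho>) * norm (cont_weight p z))"
      proof (intro mult_right_mono mult_left_mono power_mono)
        have "norm w \<le> norm z + norm (complex_of_real s)" unfolding s(3) by (rule norm_triangle_ineq)
        moreover have "norm (complex_of_real s) \<le> 1" using s(1,2) by simp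
        ultimately have "norm w \<le> norm z + 1" by (rule order_trans[OF _ add_left_mono])
        also have "\<dots> \<le> 2 * (1 + norm z) - 1" by simp
        finally show "1 + norm w \<le> 2 * (1 + norm z)" by simp
      qed (use A in auto)
      also have "\<dots> = K * ((1 + norm z) ^ d * norm (cont_weight p z))"
        unfolding K_def power_mult_distrib by (simp only: mult_ac)
      finally show "norm (g w) \<le> K * ((1 + norm z) ^ d * norm (cont_weight p z))" .
    qed auto
    thus ?thesis by (simp add: F_def)
  qed
  ultimately show ?thesis by (rule that)
qed

subsection \<open>Orthogonality on the contour\<close>

lemma borel_measurable_vector_derivative:
  assumes "C piecewise_C1_differentiable_on UNIV"
  shows   "(\<lambda>t. vector_derivative C (at t)) \<in> borel_measurable borel"
proof -
  from assms obtain S where S: "finite S" "C C1_differentiable_on (UNIV - S)"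
    by (auto simp: piecewise_C1_differentiable_on_def)
  hence "continuous_on (- S) (\<lambda>t. vector_derivative C (at t))"
    by (simp add: C1_differentiable_on_eq Compl_eq_Diff_UNIV)
  with S(1) show ?thesis
    by (intro borel_measurable_continuous_countable_exceptions[of S]) (auto intro: countable_finite)
qed

text \<open>Displacement is at most arc length. Measuring the length over the larger set X makes the
  bound uniform in a and b; X will be a half-line.\<close>

lemma norm_diff_le_set_integral:
  fixes C :: "real \<Rightarrow> complex"
  assumes C: "C piecewise_C1_differentiable_on UNIV"
    and X: "X \<in> sets borel" "set_integrable lborel X (\<lambda>t. vector_derivative C (at t))"
    and ab: "a \<le> b" "{a..b} \<subseteq> X"
  shows "norm (C b - C a) \<le> (LINT t:X|lborel. norm (vector_derivative C (at t)))"
proof -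
  from C obtain S where S: "finite S" "C C1_differentiable_on (UNIV - S)" "continuous_on UNIV C"
    by (auto simp: piecewise_C1_differentiable_on_def)
  have "((\<lambda>t. vector_derivative C (at t)) has_integral (C b - C a)) {a..b}"
  proof (rule fundamental_theorem_of_calculus_interior_strong[OF S(1) ab(1)])
    fix t assume "t \<in> {a<..<b} - S"
    hence "C differentiable at t" using S(2) by (auto simp: C1_differentiable_on_eq)
    thus "(C has_vector_derivative vector_derivative C (at t)) (at t)"
      by (simp add: vector_derivative_works)
  qed (use S(3) continuous_on_subset in blast)
  moreover have int: "set_integrable lborel {a..b} (\<lambda>t. vector_derivative C (at t))"
    by (rule set_integrable_subset[OF X(2)]) (use ab in auto)
  ultimately have "C b - C a = (LINT t:{a..b}|lborel. vector_derivative C (at t))"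
    by (simp add: set_borel_integral_eq_integral integral_unique)
  also have "norm \<dots> \<le> (LINT t|lborel. norm (indicator {a..b} t *\<^sub>R vector_derivative C (at t)))"
    unfolding set_lebesgue_integral_def by (rule integral_norm_bound)
  also have "\<dots> \<le> (LINT t|lborel. norm (indicator X t *\<^sub>R vector_derivative C (at t)))"
    using int X(2) ab unfolding set_integrable_def
    by (intro integral_mono integrable_norm) (auto simp: indicator_def)
  also have "\<dots> = (LINT t:X|lborel. norm (vector_derivative C (at t)))"
    unfolding set_lebesgue_integral_def by (intro Bochner_Integration.integral_cong) (auto simp: indicator_def)
  finally show ?thesis .
qed

text \<open>On X the speed is dominated by 1 / \<epsilon> times the integrable function.\<close>

lemma set_integrable_vector_derivative:
  fixes C :: "real \<Rightarrow> complex"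
  assumes C: "C piecewise_C1_differentiable_on UNIV" and X: "X \<in> sets borel"
    and int: "integrable lborel (\<lambda>t. E t * norm (vector_derivative C (at t)))"
    and \<epsilon>: "\<epsilon> > 0" "\<And>t. t \<in> X \<Longrightarrow> E t \<ge> \<epsilon>"
  shows "set_integrable lborel X (\<lambda>t. vector_derivative C (at t))"
  unfolding set_integrable_def
proof (rule Bochner_Integration.integrable_bound)
  show "integrable lborel (\<lambda>t. (1 / \<epsilon>) * (E t * norm (vector_derivative C (at t))))"
    using int by (rule integrable_mult_right)
  show "(\<lambda>t. indicator X t *\<^sub>R vector_derivative C (at t)) \<in> borel_measurable lborel"
    using borel_measurable_vector_derivative[OF C] X by measurable
  have "norm (indicator X t *\<^sub>R vector_derivative C (at t)) \<le>
        norm ((1 / \<epsilon>) * (E t * norm (vector_derivative C (at t))))" for t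
  proof (cases "t \<in> X")
    case True
    have "\<epsilon> * norm (vector_derivative C (at t)) \<le> \<bar>E t\<bar> * norm (vector_derivative C (at t))"
      using \<epsilon>(2)[OF True] by (intro mult_right_mono) auto
    thus ?thesis using True \<epsilon>(1) by (simp add: field_simps abs_mult)
  qed simp
  thus "AE t in lborel. norm (indicator X t *\<^sub>R vector_derivative C (at t)) \<le>
        norm ((1 / \<epsilon>) * (E t * norm (vector_derivative C (at t))))" by simp
qed

text \<open>An arc on which the integrable density \<open>E\<close> stays away from \<open>0\<close> has finite length.\<close>

lemma unbounded_arc_small:
  fixes C :: "real \<Rightarrow> complex"
  assumes sep: "separating_contour C"
    and int: "integrable lborel (\<lambda>t. E t * norm (vector_derivative C (at t)))"
    and \<epsilon>: "\<epsilon> > (0::real)"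
  shows "\<exists>t\<ge>T. E t < \<epsilon>" and "\<exists>t\<le>T. E t < \<epsilon>"
proof -
  from sep have C: "C piecewise_C1_differentiable_on UNIV"
    and lim: "filterlim (\<lambda>t. Im (C t)) at_bot at_bot" "filterlim (\<lambda>t. Im (C t)) at_top at_top"
    by (auto simp: separating_contour_def)
  show "\<exists>t\<ge>T. E t < \<epsilon>"
  proof (rule ccontr)
    assume "\<not> ?thesis"
    hence *: "set_integrable lborel {T..} (\<lambda>t. vector_derivative C (at t))"
      by (intro set_integrable_vector_derivative[OF C _ int \<epsilon>]) (auto simp: not_less)
    define L where "L = (LINT t:{T..}|lborel. norm (vector_derivative C (at t)))"
    have "eventually (\<lambda>t. t \<ge> T \<and> Im (C t) \<ge> Im (C T) + L + 1) at_top"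
      using lim(2) by (intro eventually_conj eventually_ge_at_top) (auto simp: filterlim_at_top)
    then obtain t where t: "t \<ge> T" "Im (C t) \<ge> Im (C T) + L + 1"
      using eventually_happens'[OF trivial_limit_at_top_linorder] by auto
    have "norm (C t - C T) \<le> L"
      unfolding L_def by (rule norm_diff_le_set_integral[OF C _ *]) (use t in auto)
    with t abs_Im_le_cmod[of "C t - C T"] show False by simp
  qed
  show "\<exists>t\<le>T. E t < \<epsilon>"
  proof (rule ccontr)
    assume "\<not> ?thesis"
    hence *: "set_integrable lborel {..T} (\<lambda>t. vector_derivative C (at t))"
      by (intro set_integrable_vector_derivative[OF C _ int \<epsilon>]) (auto simp: not_less)
    define L where "L = (LINT t:{..T}|lborel. norm (vector_derivative C (at t)))"
    have "eventually (\<lambda>t. t \<le> T \<and> Im (C t) \<le> Im (C T) - L - 1) at_bot"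
      using lim(1) by (intro eventually_conj eventually_le_at_bot) (auto simp: filterlim_at_bot)
    then obtain t where t: "t \<le> T" "Im (C t) \<le> Im (C T) - L - 1"
      using eventually_happens'[OF trivial_limit_at_bot_linorder] by auto
    have "norm (C T - C t) \<le> L"
      unfolding L_def by (rule norm_diff_le_set_integral[OF C _ *]) (use t in auto)
    with t abs_Im_le_cmod[of "C T - C t"] show False by simp
  qed
qed

lemma continuous_cont_weight_contour:
  assumes "p \<noteq> 0" "p \<noteq> 1" "continuous_on UNIV C" "\<And>t. C t \<notin> \<int>"
  shows   "continuous_on UNIV (\<lambda>t. cont_weight p (C t))"
  by (rule continuous_on_compose2[OF holomorphic_on_imp_continuous_on[OF holomorphic_cont_weight[OF assms(1,2)]] assms(3)])
     (use assms in auto)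

text \<open>The hypothesis concerns polynomials only; (1 + |z|)^d is at most 2^d (1 + |z|^d), which
  the polynomials 1 and z^d control.\<close>

lemma integrable_weight_growth:
  assumes p: "p \<noteq> 0" "p \<noteq> 1" and sep: "separating_contour C" and wi: "weight_integrable p C"
  shows "integrable lborel (\<lambda>t. (1 + norm (C t)) ^ d * norm (cont_weight p (C t)) * norm (vector_derivative C (at t)))"
proof (rule Bochner_Integration.integrable_bound)
  from sep have C: "C piecewise_C1_differentiable_on UNIV" and cont: "continuous_on UNIV C"
    by (auto simp: separating_contour_def piecewise_C1_differentiable_on_def)
  let ?h = "\<lambda>r t. poly r (C t) * cont_weight p (C t) * vector_derivative C (at t)"
  show "integrable lborel (\<lambda>t. 2 ^ d * (norm (?h 1 t) + norm (?h (monom 1 d) t)))"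
    using wi unfolding weight_integrable_def
    by (intro integrable_mult_right Bochner_Integration.integrable_add integrable_norm) blast+
  have [measurable]: "C \<in> borel_measurable borel" "(\<lambda>t. cont_weight p (C t)) \<in> borel_measurable borel"
    "(\<lambda>t. vector_derivative C (at t)) \<in> borel_measurable borel"
    using continuous_cont_weight_contour[OF p cont separating_contour_avoids_Ints[OF sep]] cont
      borel_measurable_vector_derivative[OF C]
    by (auto intro: borel_measurable_continuous_onI)
  show "(\<lambda>t. (1 + norm (C t)) ^ d * norm (cont_weight p (C t)) * norm (vector_derivative C (at t))) \<in> borel_measurable lborel"
    by measurable
  have "(1 + norm (C t)) ^ d * norm (cont_weight p (C t)) * norm (vector_derivative C (at t)) \<le>
      2 ^ d * (norm (?h 1 t) + norm (?h (monom 1 d) t))" for t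
  proof -
    have "(1 + norm (C t)) ^ d \<le> 2 ^ d * (1 + norm (C t) ^ d)"
    proof (cases "norm (C t) \<le> 1")
      case True
      hence "(1 + norm (C t)) ^ d \<le> 2 ^ d" by (intro power_mono) auto
      also have "2 ^ d * 1 \<le> 2 ^ d * (1 + norm (C t) ^ d)" by (intro mult_left_mono) auto
      finally show ?thesis by simp
    next
      case False
      hence "(1 + norm (C t)) ^ d \<le> (2 * norm (C t)) ^ d" by (intro power_mono) auto
      also have "\<dots> \<le> 2 ^ d * (1 + norm (C t) ^ d)" by (simp add: power_mult_distrib)
      finally show ?thesis .
    qed
    hence "(1 + norm (C t)) ^ d * (norm (cont_weight p (C t)) * norm (vector_derivative C (at t))) \<le>
        2 ^ d * (1 + norm (C t) ^ d) * (norm (cont_weight p (C t)) * norm (vector_derivative C (at t)))"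
      by (intro mult_right_mono) auto
    thus ?thesis by (simp add: norm_mult poly_monom norm_power algebra_simps)
  qed
  thus "AE t in lborel. norm ((1 + norm (C t)) ^ d * norm (cont_weight p (C t)) * norm (vector_derivative C (at t))) \<le>
      norm (2 ^ d * (norm (?h 1 t) + norm (?h (monom 1 d) t)))"
    by (intro AE_I2) (auto simp: abs_mult)
qed

text \<open>The integral over a long arc is a difference of two values of F. Integrability does not
  force these to tend to 0 along the whole curve, so the arcs are exhausted along chosen endpoints
  at which the bound E on F is small.\<close>

lemma integral_shift_op_eq_0:
  assumes p: "p \<noteq> 0" "p \<noteq> 1" and sep: "separating_contour C" and wi: "weight_integrable p C"
    and q: "is_poly q"
  shows "(LINT t|lborel. shift_op p q (C t) * cont_weight p (C t) * vector_derivative C (at t)) = 0"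
proof -
  from sep have C: "C piecewise_C1_differentiable_on UNIV" and cont: "continuous_on UNIV C"
    and lim: "filterlim (\<lambda>t. Im (C t)) at_bot at_bot" "filterlim (\<lambda>t. Im (C t)) at_top at_top"
    by (auto simp: separating_contour_def piecewise_C1_differentiable_on_def)
  obtain Q where Q: "q = poly Q" using q by (auto simp: is_poly_def)
  define G where "G z = shift_op p q z * cont_weight p z" for z
  define f where "f t = G (C t) * vector_derivative C (at t)" for t
  have "is_poly (shift_op p q)"
    unfolding shift_op_def[abs_def] using q by (intro is_poly_intros)
  then obtain r where r: "shift_op p q = poly r" by (auto simp: is_poly_def)
  have f_int: "integrable lborel f"
    using wi unfolding f_def G_def r weight_integrable_def by blast
  obtain F K d where F: "\<And>z. z \<in> cut_plane \<Longrightarrow> (F has_field_derivative G z) (at z)"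
    and K: "K \<ge> 0" "\<And>z. \<bar>Im z\<bar> \<ge> 1 \<Longrightarrow> norm (F z) \<le> K * ((1 + norm z) ^ d * norm (cont_weight p z))"
    using shift_op_primitive[OF p, of Q] unfolding G_def Q by metis
  define E where "E t = (1 + norm (C t)) ^ d * norm (cont_weight p (C t))" for t
  have E_int: "integrable lborel (\<lambda>t. E t * norm (vector_derivative C (at t)))"
    unfolding E_def by (rule integrable_weight_growth) fact+
  have "G holomorphic_on - \<int>"
    unfolding G_def r using holomorphic_cont_weight[OF p] by (intro holomorphic_intros)
  from contour_integral_subarc_primitive[OF sep this F]
  obtain T where T: "T > 0" "\<And>a b. a \<le> - T \<Longrightarrow> b \<ge> T \<Longrightarrow> contour_integral (subarc C a b) G = F (C b) - F (C a)"
    by blast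
  from lim(1) obtain t1 where t1: "\<And>t. t \<le> t1 \<Longrightarrow> Im (C t) \<le> - 1"
    unfolding filterlim_at_bot eventually_at_bot_linorder by meson
  from lim(2) obtain t2 where t2: "\<And>t. t \<ge> t2 \<Longrightarrow> Im (C t) \<ge> 1"
    unfolding filterlim_at_top eventually_at_top_linorder by meson
  define R where "R = max T (max (-t1) t2)"
  \<comment> \<open>The endpoints escape to infinity at least as fast as n, so that the arcs exhaust
    the curve, while E there is below 1 / (n + 1).\<close>
  have "\<forall>n. \<exists>b\<ge>R + real n. E b < 1 / real (Suc n)"
    using unbounded_arc_small(1)[OF sep E_int] by simp
  then obtain b where b: "\<And>n. b n \<ge> R + real n" "\<And>n. E (b n) < 1 / real (Suc n)" by metis
  have "\<forall>n. \<exists>a\<le>- (R + real n). E a < 1 / real (Suc n)"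
    using unbounded_arc_small(2)[OF sep E_int] by simp
  then obtain a where a: "\<And>n. a n \<le> - (R + real n)" "\<And>n. E (a n) < 1 / real (Suc n)" by metis
  have ab: "a n \<le> -T" "b n \<ge> T" "a n < b n" "Im (C (a n)) \<le> -1" "Im (C (b n)) \<ge> 1" for n
    using a(1)[of n] b(1)[of n] T(1) by (auto simp: R_def intro!: t1 t2)
  define I where "I n = (LINT t:{a n..b n}|lborel. f t)" for n
  have "I \<longlonglongrightarrow> (LINT t|lborel. f t)"
    unfolding I_def set_lebesgue_integral_def
  proof (rule integral_dominated_convergence[where w = "\<lambda>t. norm (f t)"])
    show "f \<in> borel_measurable lborel" "integrable lborel (\<lambda>t. norm (f t))"
      using f_int by auto
    show "(\<lambda>t. indicator {a n..b n} t *\<^sub>R f t) \<in> borel_measurable lborel" for n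
      using f_int by measurable
    show "AE t in lborel. (\<lambda>n. indicator {a n..b n} t *\<^sub>R f t) \<longlonglongrightarrow> f t"
    proof (intro AE_I2 tendsto_eventually)
      fix t :: real
      obtain m :: nat where m: "\<bar>t\<bar> < real m" using reals_Archimedean2 by blast
      show "eventually (\<lambda>n. indicator {a n..b n} t *\<^sub>R f t = f t) sequentially"
        using eventually_ge_at_top[of m]
      proof eventually_elim
        case (elim n)
        hence "real m \<le> real n" by simp
        hence "t \<in> {a n..b n}" using a(1)[of n] b(1)[of n] m T(1) by (auto simp: R_def)
        thus ?case by simp
      qed
    qed
  qed (auto simp: indicator_def)
  moreover have "I \<longlonglongrightarrow> 0"
  proof (rule Lim_null_comparison)
    have "norm (I n) \<le> 2 * K * (1 / real (Suc n))" for n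
    proof -
      have "set_integrable lborel {a n..b n} f"
        unfolding set_integrable_def using f_int by (intro integrable_mult_indicator) auto
      hence "(f has_integral I n) {a n..b n}"
        unfolding I_def by (simp add: set_borel_integral_eq_integral integrable_integral)
      hence "contour_integral (subarc C (a n) (b n)) G = I n"
        unfolding f_def by (intro contour_integral_unique contour_integral_subarc[OF C ab(3)])
      hence "I n = F (C (b n)) - F (C (a n))"
        using T(2)[OF ab(1,2)] by simp
      also have "norm \<dots> \<le> norm (F (C (b n))) + norm (F (C (a n)))"
        by (rule norm_triangle_ineq4)
      also have "\<dots> \<le> K * E (b n) + K * E (a n)"
        unfolding E_def using ab(4,5)[of n] by (intro add_mono K(2)) auto
      also have "\<dots> \<le> K * (1 / real (Suc n)) + K * (1 / real (Suc n))"
        using a(2)[of n] b(2)[of n] K(1) by (intro add_mono mult_left_mono) auto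
      finally show ?thesis by simp
    qed
    thus "eventually (\<lambda>n. norm (I n) \<le> 2 * K * (1 / real (Suc n))) sequentially" by simp
    show "(\<lambda>n. 2 * K * (1 / real (Suc n))) \<longlonglongrightarrow> 0"
      by (intro tendsto_mult_right_zero LIMSEQ_Suc lim_1_over_n)
  qed
  ultimately have "(LINT t|lborel. f t) = 0" by (rule LIMSEQ_unique)
  thus ?thesis by (simp add: f_def G_def)
qed

text \<open>By the Lagrange identity at \<nu> = -1, \<open>(\<kappa> - \<mu>) * (y x * u x)\<close>
  is \<open>shift_op\<close> of the Casoratian of y and u, whose weighted integral vanishes.\<close>

lemma cont_form_eigen_orthogonal:
  assumes p: "p \<noteq> 0" "p \<noteq> 1" and sep: "separating_contour C" and wi: "weight_integrable p C"
    and y: "is_poly y" "\<And>x. kdiff p (-1) y x = \<kappa> * y x"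
    and u: "is_poly u" "\<And>x. kdiff p (-1) u x = \<mu> * u x"
    and "\<kappa> \<noteq> \<mu>"
  shows "cont_form p C y u = 0"
proof -
  have "is_poly (casorati y u)"
    using y(1) u(1) is_poly_intros(6)[of _ "-1"] unfolding casorati_def[abs_def]
    by (intro is_poly_intros) auto
  from integral_shift_op_eq_0[OF p sep wi this]
  have "0 = (LINT t|lborel. shift_op p (casorati y u) (C t) * cont_weight p (C t) * vector_derivative C (at t))" ..
  also have "shift_op p (casorati y u) = (\<lambda>x. (\<kappa> - \<mu>) * (y x * u x))"
  proof
    fix x
    have "shift_op p (casorati y u) x = kdiff p (-1) y x * u x - y x * kdiff p (-1) u x"
      unfolding kdiff_casorati shift_op_def by (simp add: algebra_simps)
    thus "shift_op p (casorati y u) x = (\<kappa> - \<mu>) * (y x * u x)"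
      unfolding y(2) u(2) by (simp add: algebra_simps)
  qed
  also have "(LINT t|lborel. (\<kappa> - \<mu>) * (y (C t) * u (C t)) * cont_weight p (C t) * vector_derivative C (at t)) =
      (\<kappa> - \<mu>) * cont_form p C y u"
    unfolding cont_form_def by (subst integral_mult_right_zero [symmetric]) (simp add: mult_ac)
  finally show ?thesis using \<open>\<kappa> \<noteq> \<mu>\<close> by simp
qed

text \<open>The two parts of the form vanish separately; on the contour the eigenvalues are N + 1 -
  n and N + 1 - m.\<close>

lemma sobolev_form_krawtchouk:
  assumes p: "p \<noteq> 0" "p \<noteq> 1" and sep: "separating_contour C" and wi: "weight_integrable p C"
    and "n \<noteq> m"
  shows "sobolev_form p N C (krawtchouk n p N) (krawtchouk m p N) = 0"
proof -
  have eigen: "kdiff p (-1) ((fwd_diff ^^ (N + 1)) (krawtchouk k p N)) x =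
      (- of_nat k + of_nat (N + 1)) * (fwd_diff ^^ (N + 1)) (krawtchouk k p N) x" for k x
    using fwd_diff_eigen[where k = "N + 1", OF krawtchouk_eigen, of p N k x] by simp
  have "cont_form p C ((fwd_diff ^^ (N + 1)) (krawtchouk n p N)) ((fwd_diff ^^ (N + 1)) (krawtchouk m p N)) = 0"
    using assms(5)
    by (intro cont_form_eigen_orthogonal[OF p sep wi is_poly_fwd_diff[OF is_poly_krawtchouk] eigen
          is_poly_fwd_diff[OF is_poly_krawtchouk] eigen]) auto
  thus ?thesis
    by (simp add: sobolev_form_def discrete_form_krawtchouk[OF assms(5)] del: funpow.simps)
qed

subsection \<open>Parabolic contours\<close>

text \<open>Parametrised by the imaginary part and passing through -1/2, with \<sigma> = 0 as the
  straight line. The real part is quadratic in t, so the modulus of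
  \<open>(p / (1 - p)) powr z\<close> gets a Gaussian factor whose sign in the exponent is that of
  \<sigma> ln |p / (1 - p)|.\<close>

definition parabola :: "real \<Rightarrow> real \<Rightarrow> complex" where
  "parabola \<sigma> t = Complex (\<sigma> * t\<^sup>2 - 1 / 2) t"

lemma vertical_line_eq_parabola: "vertical_line = parabola 0"
  by (auto simp: vertical_line_def parabola_def complex_eq_iff)

lemma parabola_eq: "parabola \<sigma> t = of_real (\<sigma> * t\<^sup>2 - 1 / 2) + of_real t * \<i>"
  by (simp add: parabola_def complex_eq_iff)

lemma has_vector_derivative_parabola:
  "(parabola \<sigma> has_vector_derivative Complex (2 * \<sigma> * t) 1) (at t)"
proof -
  have "((\<lambda>t. of_real (\<sigma> * t\<^sup>2 - 1 / 2) + of_real t * \<i>) has_vector_derivative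
         (of_real (2 * \<sigma> * t) + of_real 1 * \<i>)) (at t)"
    by (intro has_vector_derivative_add has_vector_derivative_of_real
        has_vector_derivative_mult_left) (auto intro!: derivative_eq_intros)
  also have "(\<lambda>t. of_real (\<sigma> * t\<^sup>2 - 1 / 2) + of_real t * \<i>) = parabola \<sigma>"
    unfolding parabola_eq ..
  also have "of_real (2 * \<sigma> * t) + of_real 1 * \<i> = Complex (2 * \<sigma> * t) 1"
    by (simp add: complex_eq_iff)
  finally show ?thesis .
qed

text \<open>The curve is the zero set of h(z) = Re z + 1/2 - \<sigma> (Im z)^2. On the real axis h
  is x + 1/2, so each half-axis links one sequence of poles, and by the intermediate value theorem
  no connected set off the curve joins the two signs.\<close>

lemma separating_contour_parabola: "separating_contour (parabola \<sigma>)"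
proof -
  have range: "z \<in> range (parabola \<sigma>) \<longleftrightarrow> Re z + 1 / 2 - \<sigma> * (Im z)\<^sup>2 = 0" for z
    by (auto simp: parabola_def complex_eq_iff image_iff)
  have cont: "continuous_on UNIV (\<lambda>t. Complex (2 * \<sigma> * t) 1)"
    unfolding Complex_eq by (intro continuous_intros)
  have "parabola \<sigma> C1_differentiable_on UNIV"
    unfolding C1_differentiable_on_def
    by (intro exI[of _ "\<lambda>t. Complex (2 * \<sigma> * t) 1"] conjI ballI has_vector_derivative_parabola cont)
  hence 1: "parabola \<sigma> piecewise_C1_differentiable_on UNIV"
    by (rule C1_differentiable_imp_piecewise)
  have 2: "filterlim (\<lambda>t. Im (parabola \<sigma> t)) at_bot at_bot" "filterlim (\<lambda>t. Im (parabola \<sigma> t)) at_top at_top"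
    by (simp_all add: parabola_def filterlim_ident)
  have 3: "connected_component (- range (parabola \<sigma>)) a b"
    if "a \<in> increasing_poles" "b \<in> increasing_poles" for a b
    unfolding connected_component_def
  proof (intro exI[of _ "complex_of_real ` {-1/2<..}"] conjI)
    show "connected (complex_of_real ` {-1/2<..})"
      by (intro connected_continuous_image continuous_intros) auto
    show "complex_of_real ` {-1/2<..} \<subseteq> - range (parabola \<sigma>)"
      unfolding subset_iff Compl_iff range by auto
    show "a \<in> complex_of_real ` {-1/2<..}" "b \<in> complex_of_real ` {-1/2<..}"
      using that by (auto simp: increasing_poles_def intro!: image_eqI[where x = "real _"])
  qed
  have 4: "connected_component (- range (parabola \<sigma>)) a b"
    if "a \<in> decreasing_poles" "b \<in> decreasing_poles" for a b
    unfolding connected_component_def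
  proof (intro exI[of _ "complex_of_real ` {..<-1/2}"] conjI)
    show "connected (complex_of_real ` {..<-1/2})"
      by (intro connected_continuous_image continuous_intros) auto
    show "complex_of_real ` {..<-1/2} \<subseteq> - range (parabola \<sigma>)"
      unfolding subset_iff Compl_iff range by auto
    show "a \<in> complex_of_real ` {..<-1/2}" "b \<in> complex_of_real ` {..<-1/2}"
      using that by (auto simp: decreasing_poles_def intro!: image_eqI[where x = "- real (Suc _)"])
  qed
  have 5: "\<not> connected_component (- range (parabola \<sigma>)) a b"
    if ab: "a \<in> increasing_poles" "b \<in> decreasing_poles" for a b
  proof
    define h where "h z = Re z + 1 / 2 - \<sigma> * (Im z)\<^sup>2" for z
    assume "connected_component (- range (parabola \<sigma>)) a b"
    then obtain S where S: "connected S" "S \<subseteq> - range (parabola \<sigma>)" "a \<in> S" "b \<in> S"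
      by (auto simp: connected_component_def)
    have "connected (h ` S)"
      unfolding h_def by (intro connected_continuous_image S(1) continuous_intros)
    moreover have "h b \<le> 0" "0 \<le> h a"
      using ab by (auto simp: h_def increasing_poles_def decreasing_poles_def)
    ultimately have "0 \<in> h ` S"
      using connectedD_interval[of "h ` S" "h b" "h a" 0] S(3,4) by blast
    then obtain z where z: "z \<in> S" "h z = 0" by auto
    hence "z \<in> range (parabola \<sigma>)" unfolding range h_def by simp
    with S(2) z(1) show False by blast
  qed
  show ?thesis
    unfolding separating_contour_def by (intro conjI ballI 1 2 3 4 5)
qed

section \<open>Integrability of the weight along parabolas\<close>

lemma norm_weight_parabola:
  assumes "p \<noteq> 0" "p \<noteq> 1"
  shows "norm (cont_weight p (parabola \<sigma> t)) = pi / norm (sin (of_real pi * parabola \<sigma> t)) *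
     exp ((\<sigma> * t\<^sup>2 - 1 / 2) * ln (norm (p / (1 - p))) - t * Im (Ln (p / (1 - p))))"
proof -
  have "p / (1 - p) \<noteq> 0" using assms by simp
  thus ?thesis
    by (simp add: cont_weight_sin norm_mult norm_divide powr_def parabola_def)
qed

lemma integrable_inverse_1_plus_square_lborel:
  "integrable lborel (\<lambda>t::real. inverse (1 + t\<^sup>2))"
  using integrable_inverse_1_plus_square by (simp add: set_integrable_def)

text \<open>The sine contributes -pi |t| to the exponent and the power contributes \<sigma> L
  \<open>t\<^sup>2\<close> - t \<theta> with |\<theta>| <= pi. Either the quadratic term is negative
  and wins, or \<sigma> = 0 and |\<theta>| < pi; in both cases exponential decay beats every
  polynomial.\<close>

lemma integrable_weight_parabola:
  fixes r :: "complex poly"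
  assumes p: "p \<noteq> 0" "p \<noteq> 1"
    and \<sigma>: "\<sigma> * ln (norm (p / (1 - p))) < 0 \<or> \<sigma> = 0 \<and> p / (1 - p) \<notin> \<real>\<^sub>\<le>\<^sub>0"
  shows "integrable lborel (\<lambda>t. poly r (parabola \<sigma> t) * cont_weight p (parabola \<sigma> t) *
           vector_derivative (parabola \<sigma>) (at t))"
proof -
  define \<rho> where "\<rho> = p / (1 - p)"
  have \<rho>: "\<rho> \<noteq> 0" using p by (simp add: \<rho>_def)
  define L where "L = ln (norm \<rho>)"
  define \<theta> where "\<theta> = Im (Ln \<rho>)"
  have \<theta>: "\<bar>\<theta>\<bar> \<le> pi"
    using mpi_less_Im_Ln[OF \<rho>] Im_Ln_le_pi[OF \<rho>] by (simp add: \<theta>_def)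
  have "\<exists>\<delta>>0. \<exists>B. \<forall>t. \<sigma> * t\<^sup>2 * L - t * \<theta> - pi * \<bar>t\<bar> \<le> B - \<delta> * \<bar>t\<bar>"
    using \<sigma> unfolding \<rho>_def [symmetric] L_def [symmetric]
  proof
    \<comment> \<open>The parabola lies above its tangents at |t| = 1, which yields B = - \<sigma> L
      and \<delta> = -2 \<sigma> L; the term in \<theta> is absorbed by pi |t|.\<close>
    assume neg: "\<sigma> * L < 0"
    have "\<sigma> * t\<^sup>2 * L - t * \<theta> - pi * \<bar>t\<bar> \<le> - (\<sigma> * L) - (- 2 * (\<sigma> * L)) * \<bar>t\<bar>" for t
    proof -
      have "0 \<le> (\<bar>t\<bar> - 1)\<^sup>2" by simp
      hence "2 * \<bar>t\<bar> - 1 \<le> t\<^sup>2" by (simp add: power2_eq_square algebra_simps)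
      hence "(\<sigma> * L) * t\<^sup>2 \<le> (\<sigma> * L) * (2 * \<bar>t\<bar> - 1)" using neg by (intro mult_left_mono_neg) auto
      moreover have "- t * \<theta> \<le> \<bar>t\<bar> * pi"
        using mult_left_mono[OF \<theta>, of "\<bar>t\<bar>"] abs_ge_self[of "- t * \<theta>"] by (simp add: abs_mult)
      ultimately show ?thesis by (simp add: algebra_simps)
    qed
    moreover have "- 2 * (\<sigma> * L) > 0" using neg by linarith
    ultimately show ?thesis by blast
  next
    \<comment> \<open>The principal argument is never -pi, and it equals pi only on the negative
      real axis.\<close>
    assume *: "\<sigma> = 0 \<and> \<rho> \<notin> \<real>\<^sub>\<le>\<^sub>0"
    hence "\<theta> \<noteq> pi" "\<theta> \<noteq> - pi"
      using Im_Ln_eq_pi[OF \<rho>] mpi_less_Im_Ln[OF \<rho>] by (auto simp: \<theta>_def complex_nonpos_Reals_iff)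
    hence "\<bar>\<theta>\<bar> < pi" using \<theta> by auto
    moreover have "- t * \<theta> - pi * \<bar>t\<bar> \<le> 0 - (pi - \<bar>\<theta>\<bar>) * \<bar>t\<bar>" for t
      using abs_ge_self[of "- t * \<theta>"] by (simp add: abs_mult algebra_simps)
    hence "\<sigma> * t\<^sup>2 * L - t * \<theta> - pi * \<bar>t\<bar> \<le> 0 - (pi - \<bar>\<theta>\<bar>) * \<bar>t\<bar>" for t
      using * by simp
    moreover have "pi - \<bar>\<theta>\<bar> > 0" using \<open>\<bar>\<theta>\<bar> < pi\<close> by simp
    ultimately show ?thesis by blast
  qed
  then obtain \<delta> B where \<delta>: "\<delta> > 0" and B: "\<And>t. \<sigma> * t\<^sup>2 * L - t * \<theta> - pi * \<bar>t\<bar> \<le> B - \<delta> * \<bar>t\<bar>"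
    by blast
  define f where "f t = poly r (parabola \<sigma> t) * cont_weight p (parabola \<sigma> t) * Complex (2 * \<sigma> * t) 1" for t
  obtain A d where A: "A \<ge> 0" "\<And>z. norm (poly r z) \<le> A * (1 + norm z) ^ d"
    using norm_poly_le[of r] by auto
  \<comment> \<open>The 4 comes from the lower bound of the sine, the shift by L / 2 from the
    abscissa -1/2.\<close>
  define W where "W = 4 * pi * exp (B - L / 2)"
  define c where "c = 3 + \<bar>\<sigma>\<bar>"
  define D where "D = 2 * A * c ^ d * W * (1 + 2 * \<bar>\<sigma>\<bar>)"
  have "D \<ge> 0" using A by (auto simp: D_def W_def c_def)
  \<comment> \<open>The factor 1 + \<open>t\<^sup>2\<close> prepares the comparison with its
    integrable inverse. The exponent 2 d + 3 collects 2 d from the polynomial, 1 from the derivative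
    of the curve and 2 from this factor.\<close>
  have decay: "norm (f t) * (1 + t\<^sup>2) \<le> D * (\<bar>t\<bar> ^ (2 * d + 3) * exp (- \<delta> * \<bar>t\<bar>))" if t: "\<bar>t\<bar> \<ge> 1" for t
  proof -
    have t2: "\<bar>t\<bar> \<le> t\<^sup>2" "1 \<le> t\<^sup>2"
      using t mult_left_mono[OF t, of "\<bar>t\<bar>"] by (auto simp: power2_eq_square)
    have 1: "norm (poly r (parabola \<sigma> t)) \<le> A * (c * \<bar>t\<bar>\<^sup>2) ^ d"
    proof -
      have "norm (parabola \<sigma> t) \<le> \<bar>\<sigma> * t\<^sup>2 - 1 / 2\<bar> + \<bar>t\<bar>"
        using cmod_le[of "parabola \<sigma> t"] by (simp add: parabola_def)
      also have "\<dots> \<le> \<bar>\<sigma>\<bar> * t\<^sup>2 + 1 / 2 + \<bar>t\<bar>"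
        using abs_triangle_ineq4[of "\<sigma> * t\<^sup>2" "1 / 2"] by (simp add: abs_mult)
      finally have "1 + norm (parabola \<sigma> t) \<le> c * \<bar>t\<bar>\<^sup>2"
        using t2 by (simp add: c_def algebra_simps)
      hence "A * (1 + norm (parabola \<sigma> t)) ^ d \<le> A * (c * \<bar>t\<bar>\<^sup>2) ^ d"
        using A by (intro mult_left_mono power_mono) auto
      thus ?thesis using A(2)[of "parabola \<sigma> t"] by linarith
    qed
    have 2: "norm (cont_weight p (parabola \<sigma> t)) \<le> W * exp (- \<delta> * \<bar>t\<bar>)"
    proof -
      have "1 \<le> pi * \<bar>t\<bar>" using pi_gt3 t mult_mono[of 1 pi 1 "\<bar>t\<bar>"] by simp
      hence "exp (pi * \<bar>t\<bar>) / 4 \<le> norm (sin (of_real pi * parabola \<sigma> t))"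
        using norm_sin_ge[of "of_real pi * parabola \<sigma> t"] by (simp add: parabola_def abs_mult)
      hence "pi / norm (sin (of_real pi * parabola \<sigma> t)) \<le> pi / (exp (pi * \<bar>t\<bar>) / 4)"
        by (intro divide_left_mono mult_pos_pos) (auto intro: less_le_trans[of 0 "exp (pi * \<bar>t\<bar>) / 4"])
      hence "norm (cont_weight p (parabola \<sigma> t)) \<le> pi / (exp (pi * \<bar>t\<bar>) / 4) *
          exp ((\<sigma> * t\<^sup>2 - 1 / 2) * L - t * \<theta>)"
        unfolding norm_weight_parabola[OF p] \<rho>_def[symmetric] L_def[symmetric] \<theta>_def[symmetric]
        by (intro mult_right_mono) auto
      also have "\<dots> = 4 * pi * exp ((\<sigma> * t\<^sup>2 * L - t * \<theta> - pi * \<bar>t\<bar>) - L / 2)"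
      proof -
        have "(\<sigma> * t\<^sup>2 - 1 / 2) * L - t * \<theta> =
            pi * \<bar>t\<bar> + ((\<sigma> * t\<^sup>2 * L - t * \<theta> - pi * \<bar>t\<bar>) - L / 2)"
          by (simp add: left_diff_distrib)
        thus ?thesis by (simp only: exp_add) simp
      qed
      also have "\<dots> \<le> 4 * pi * exp ((B - \<delta> * \<bar>t\<bar>) - L / 2)"
        using B[of t] by simp
      also have "\<dots> = W * exp (- \<delta> * \<bar>t\<bar>)"
      proof -
        have "(B - \<delta> * \<bar>t\<bar>) - L / 2 = (B - L / 2) + (- \<delta> * \<bar>t\<bar>)" by simp
        thus ?thesis by (simp only: exp_add W_def mult.assoc)
      qed
      finally show ?thesis .
    qed
    have 3: "norm (Complex (2 * \<sigma> * t) 1) \<le> (1 + 2 * \<bar>\<sigma>\<bar>) * \<bar>t\<bar>"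
    proof -
      have "norm (Complex (2 * \<sigma> * t) 1) \<le> 2 * \<bar>\<sigma>\<bar> * \<bar>t\<bar> + 1"
        using cmod_le[of "Complex (2 * \<sigma> * t) 1"] by (simp add: abs_mult)
      thus ?thesis using t by (simp add: algebra_simps)
    qed
    have "norm (f t) * (1 + t\<^sup>2) \<le>
        (A * (c * \<bar>t\<bar>\<^sup>2) ^ d) * (W * exp (- \<delta> * \<bar>t\<bar>)) * ((1 + 2 * \<bar>\<sigma>\<bar>) * \<bar>t\<bar>) * (2 * \<bar>t\<bar>\<^sup>2)"
      unfolding f_def norm_mult using 1 2 3 t2 A
      by (intro mult_mono mult_nonneg_nonneg) (auto simp: W_def c_def)
    also have "\<dots> = D * (\<bar>t\<bar> ^ (2 * d + 3) * exp (- \<delta> * \<bar>t\<bar>))"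
      unfolding D_def power_mult_distrib power_mult [symmetric] power_add
      by (simp add: power3_eq_cube power2_eq_square mult_ac)
    finally show ?thesis .
  qed
  have "filterlim (\<lambda>u. \<delta> * u) at_top at_top"
    using \<delta> by (intro filterlim_tendsto_pos_mult_at_top[OF tendsto_const] filterlim_ident)
  from filterlim_compose[OF tendsto_power_div_exp_0 this]
  have "((\<lambda>u. (\<delta> * u) ^ (2 * d + 3) / exp (\<delta> * u)) \<longlongrightarrow> 0) at_top" .
  hence "((\<lambda>u. (1 / \<delta>) ^ (2 * d + 3) * ((\<delta> * u) ^ (2 * d + 3) / exp (\<delta> * u))) \<longlongrightarrow> 0) at_top"
    by (rule tendsto_mult_right_zero)
  moreover have "(1 / \<delta>) ^ (2 * d + 3) * ((\<delta> * u) ^ (2 * d + 3) / exp (\<delta> * u)) =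
      u ^ (2 * d + 3) * exp (- \<delta> * u)" for u
  proof -
    have "(1 / \<delta>) ^ (2 * d + 3) * ((\<delta> * u) ^ (2 * d + 3) / exp (\<delta> * u)) =
        (1 / \<delta> * (\<delta> * u)) ^ (2 * d + 3) / exp (\<delta> * u)"
      unfolding power_mult_distrib by simp
    also have "1 / \<delta> * (\<delta> * u) = u" using \<delta> by simp
    finally show ?thesis by (simp add: exp_minus divide_inverse)
  qed
  ultimately have "eventually (\<lambda>u. u ^ (2 * d + 3) * exp (- \<delta> * u) < 1) at_top"
    by (intro order_tendstoD(2)[of _ 0]) (simp_all only: zero_less_one)
  then obtain U where U: "\<And>u. u \<ge> U \<Longrightarrow> u ^ (2 * d + 3) * exp (- \<delta> * u) < 1"
    by (auto simp: eventually_at_top_linorder)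
  have cont_C: "continuous_on UNIV (parabola \<sigma>)"
    using separating_contour_parabola by (simp add: separating_contour_def piecewise_C1_differentiable_on_def)
  have cont_w: "continuous_on UNIV (\<lambda>t. cont_weight p (parabola \<sigma> t))"
    by (rule continuous_cont_weight_contour[OF p cont_C separating_contour_avoids_Ints[OF separating_contour_parabola]])
  have cont: "continuous_on UNIV f"
    unfolding f_def Complex_eq by (intro continuous_intros cont_w cont_C)
  \<comment> \<open>Where the decay estimate is not yet effective, continuity on a compact interval
    supplies the bound.\<close>
  have "compact ((\<lambda>t. norm (f t) * (1 + t\<^sup>2)) ` {- max 1 U..max 1 U})"
    by (intro compact_continuous_image continuous_intros continuous_on_subset[OF cont]) auto
  hence "bdd_above ((\<lambda>t. norm (f t) * (1 + t\<^sup>2)) ` {- max 1 U..max 1 U})"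
    by (intro bounded_imp_bdd_above compact_imp_bounded)
  then obtain M where M: "\<And>t. t \<in> {- max 1 U..max 1 U} \<Longrightarrow> norm (f t) * (1 + t\<^sup>2) \<le> M"
    unfolding bdd_above_def by blast
  have bound: "norm (f t) * (1 + t\<^sup>2) \<le> max D M" for t
  proof (cases "t \<in> {- max 1 U..max 1 U}")
    case True
    from M[OF this] show ?thesis by simp
  next
    case False
    hence t: "\<bar>t\<bar> \<ge> 1" "\<bar>t\<bar> \<ge> U" by auto
    have "norm (f t) * (1 + t\<^sup>2) \<le> D * (\<bar>t\<bar> ^ (2 * d + 3) * exp (- \<delta> * \<bar>t\<bar>))"
      by (rule decay[OF t(1)])
    also have "\<dots> \<le> D * 1"
      using U[OF t(2)] \<open>D \<ge> 0\<close> by (intro mult_left_mono) auto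
    finally show ?thesis by simp
  qed
  have "integrable lborel f"
  proof (rule Bochner_Integration.integrable_bound)
    show "integrable lborel (\<lambda>t. max D M * inverse (1 + t\<^sup>2))"
      using integrable_inverse_1_plus_square_lborel by (rule integrable_mult_right)
    show "f \<in> borel_measurable lborel"
      using borel_measurable_continuous_onI[OF cont] by simp
    have "norm (f t) \<le> norm (max D M * inverse (1 + t\<^sup>2))" for t
    proof -
      have pos: "1 + t\<^sup>2 > 0" by (simp add: add_pos_nonneg)
      hence "norm (f t) \<le> max D M * inverse (1 + t\<^sup>2)"
        using bound[of t] by (simp add: field_simps)
      also have "\<dots> \<le> norm (max D M * inverse (1 + t\<^sup>2))" by simp
      finally show ?thesis .
    qed
    thus "AE t in lborel. norm (f t) \<le> norm (max D M * inverse (1 + t\<^sup>2))" by simp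
  qed
  also have "f = (\<lambda>t. poly r (parabola \<sigma> t) * cont_weight p (parabola \<sigma> t) *
      vector_derivative (parabola \<sigma>) (at t))"
    by (simp add: fun_eq_iff f_def vector_derivative_at[OF has_vector_derivative_parabola])
  finally show ?thesis .
qed

lemma weight_integrable_parabola:
  assumes "p \<noteq> 0" "p \<noteq> 1"
    and "\<sigma> * ln (norm (p / (1 - p))) < 0 \<or> \<sigma> = 0 \<and> p / (1 - p) \<notin> \<real>\<^sub>\<le>\<^sub>0"
  shows "weight_integrable p (parabola \<sigma>)"
  unfolding weight_integrable_def using integrable_weight_parabola[OF assms] by blast

text \<open>Here the argument is pi, so on the lower half of the line the growth of the power
  exactly offsets the decay coming from the sine. The weight stays above c there, which an
  integrable density on an arc of infinite length cannot do.\<close>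

lemma not_weight_integrable_vertical_line:
  assumes p: "p \<noteq> 0" "p \<noteq> 1" and neg: "p / (1 - p) \<in> \<real>\<^sub>\<le>\<^sub>0"
  shows "\<not> weight_integrable p vertical_line"
proof
  assume wi: "weight_integrable p vertical_line"
  define \<rho> where "\<rho> = p / (1 - p)"
  have \<rho>: "\<rho> \<noteq> 0" using p by (simp add: \<rho>_def)
  define c where "c = pi * exp (- (ln (norm \<rho>) / 2))"
  have "Im (Ln \<rho>) = pi"
    using neg \<rho> by (subst Im_Ln_eq_pi) (auto simp: \<rho>_def[symmetric] complex_nonpos_Reals_iff complex_eq_iff)
  hence E: "norm (cont_weight p (parabola 0 t)) = pi / norm (sin (of_real pi * parabola 0 t)) *
     exp (- (ln (norm \<rho>) / 2) - t * pi)" for t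
    using norm_weight_parabola[OF p, of 0 t] by (simp add: \<rho>_def[symmetric])
  have "c \<le> norm (cont_weight p (parabola 0 t))" if "t \<le> 0" for t
  proof -
    have "norm (sin (of_real pi * parabola 0 t)) \<le> exp (- t * pi)"
      using norm_sin_le[of "of_real pi * parabola 0 t"] that by (simp add: parabola_def abs_mult mult_ac)
    moreover have "of_real pi * parabola 0 t \<noteq> 0 \<and> sin (of_real pi * parabola 0 t) \<noteq> 0"
    proof -
      have "cont_weight p (parabola 0 t) \<noteq> 0"
        using separating_contour_avoids_Ints[OF separating_contour_parabola] by (intro cont_weight_nonzero p)
      thus ?thesis by (auto simp: cont_weight_sin)
    qed
    ultimately have "pi / exp (- t * pi) \<le> pi / norm (sin (of_real pi * parabola 0 t))"
      by (intro divide_left_mono mult_pos_pos) auto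
    hence "pi / exp (- t * pi) * exp (- (ln (norm \<rho>) / 2) - t * pi) \<le> norm (cont_weight p (parabola 0 t))"
      unfolding E by (intro mult_right_mono) auto
    also have "exp (- (ln (norm \<rho>) / 2) - t * pi) = exp (- t * pi) * exp (- (ln (norm \<rho>) / 2))"
      by (simp flip: exp_add)
    finally show ?thesis by (simp add: c_def)
  qed
  moreover have "integrable lborel (\<lambda>t. (1 + norm (parabola 0 t)) ^ 0 * norm (cont_weight p (parabola 0 t)) *
      norm (vector_derivative (parabola 0) (at t)))"
    using wi by (intro integrable_weight_growth p separating_contour_parabola) (simp add: vertical_line_eq_parabola)
  hence "\<exists>t\<le>0. norm (cont_weight p (parabola 0 t)) < c"
    by (intro unbounded_arc_small(2)[OF separating_contour_parabola[of 0]]) (auto simp: c_def)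
  ultimately show False by (meson not_less)
qed

text \<open>The informal statement leaves the contour open, so orthogonality is claimed for every
  separating contour with convergent integrals. The further conjuncts show that this is not vacuous
  and delimit exactly when the straight line is admissible.\<close>

theorem mainTheorem9:
  fixes N :: nat and p :: complex
  assumes "p \<noteq> 0" and "p \<noteq> 1"
  shows "(\<forall>C. separating_contour C \<and> weight_integrable p C \<longrightarrow>
            (\<forall>n m. n \<noteq> m \<longrightarrow> sobolev_form p N C (krawtchouk n p N) (krawtchouk m p N) = 0)) \<and>
         (\<exists>C. separating_contour C \<and> weight_integrable p C) \<and>
         separating_contour vertical_line \<and>
         (weight_integrable p vertical_line \<longleftrightarrow> p / (1 - p) \<notin> \<real>\<^sub>\<le>\<^sub>0)"
proof (intro conjI allI impI)
  fix C n m
  assume "separating_contour C \<and> weight_integrable p C" "n \<noteq> (m :: nat)"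
  thus "sobolev_form p N C (krawtchouk n p N) (krawtchouk m p N) = 0"
    using sobolev_form_krawtchouk[OF assms] by blast
next
  \<comment> \<open>Off the closed negative axis the line, \<sigma> = 0, will do. On it p / (1 - p)
    differs from 0 and from -1, so the logarithm of its modulus is nonzero, and taking \<sigma> as
    minus this logarithm makes the product negative.\<close>
  have "\<exists>\<sigma>. \<sigma> * ln (norm (p / (1 - p))) < 0 \<or> \<sigma> = 0 \<and> p / (1 - p) \<notin> \<real>\<^sub>\<le>\<^sub>0"
  proof (cases "p / (1 - p) \<in> \<real>\<^sub>\<le>\<^sub>0")
    case True
    then obtain x where x: "p / (1 - p) = of_real x" "x \<le> 0"
      by (auto elim: nonpos_Reals_cases)
    have "x \<noteq> 0" using x assms by auto
    moreover have "x \<noteq> -1"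
    proof
      assume "x = -1"
      with x assms have "p = p - 1" by (simp add: field_simps)
      thus False by simp
    qed
    ultimately have "ln (norm (p / (1 - p))) \<noteq> 0" using x by (auto simp del: norm_divide)
    thus ?thesis
      by (intro exI[of _ "- ln (norm (p / (1 - p)))"]) (auto simp: zero_less_mult_iff linorder_neq_iff)
  qed auto
  thus "\<exists>C. separating_contour C \<and> weight_integrable p C"
    using weight_integrable_parabola[OF assms] separating_contour_parabola by blast
next
  show "separating_contour vertical_line"
    by (simp add: vertical_line_eq_parabola separating_contour_parabola)
next
  show "weight_integrable p vertical_line \<longleftrightarrow> p / (1 - p) \<notin> \<real>\<^sub>\<le>\<^sub>0"
    using weight_integrable_parabola[OF assms, of 0] not_weight_integrable_vertical_line[OF assms]
    by (auto simp: vertical_line_eq_parabola)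
qed

end
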